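(* Let $(X_t)_{t\ge 0}$ be a regular non-explosive continuous-time Markov chain on the countable metric space $(E,d)$ with transition rates $(Q(x,y))_{x\ne y}$. Assume that $(X_t)_{t\ge0}$ has $\Gamma$-curvature bounded below by $\rho\in\mathbb{R}$. Let $f\in\mathcal{A}\cap\mathrm{Lip}_d(E)$ with $\|\Gamma f\|_\infty<+\infty$, let $t>0$, and define $\psi_{f,t}:\mathbb{R}_+\to\mathbb{R}_+\cup\{\infty\}$ by $$\psi_{f,t}(\lambda):=\sqrt{2}\,L_{t,\rho}\,\|\Gamma f\|_\infty^{1/2}\left(\sup_{x\in E}\sum_{y\in E}(f(y)-f(x))^2\left(\frac{\exp\{\lambda\|f\|_{\mathrm{Lip}_d}d(x,y)\}-1}{\|f\|_{\mathrm{Lip}_d}d(x,y)}\right)^2Q(x,y)\right)^{1/2},$$ where $L_{t,\rho}=(1-e^{-2\rho t})/(2\rho)$ if $\rho\ne0$ and $L_{t,0}=t$. Let $M_{f,t}:=\sup\{\lambda>0:\psi_{f,t}(\lambda)<+\infty\}$. Then for any $x\in E$ and any $y>0$, $$\mathbb{P}_x\big(f(X_t)-\mathbb{E}_x[f(X_t)]\ge y\big)\le\exp\left(\inf_{\lambda\in(0,M_{f,t})}\int_0^\lambda(\psi_{f,t}(\tau)-y)\,d\tau\right).$$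
   Context: $E$ is a countable set with a metric $d$ different from the trivial metric $1_{x\neq y}$. $\mathrm{Lip}_d(E)$ is the space of functions $f:E\to\mathbb{R}$ with $\|f\|_{\mathrm{Lip}_d}:=\sup_{x\ne y}|f(x)-f(y)|/d(x,y)<+\infty$, and $\|\cdot\|_\infty$ is the supremum norm on $E$. The chain $(X_t)_{t\ge0}$ is an $E$-valued regular (its rates are stable and conservative and determine the process uniquely) non-explosive continuous-time Markov chain with generator $\mathcal{L}f(x)=\sum_{y\in E}(f(y)-f(x))Q(x,y)$, where $Q(x,y)\ge0$ for $x\ne y$. $\mathbb{P}_x,\mathbb{E}_x$ refer to the chain started at $x$, and $P_tf(x)=\mathbb{E}_x[f(X_t)]$ is its semigroup. In sums over $y$, the term $y=x$ (for which $f(y)-f(x)=0$) contributes $0$. It is assumed that there is an algebra $\mathcal{A}$ of real functions on $E$ which contains the bounded functions and is stable under $\mathcal{L}$, under $P_t$ and under composition with $C^\infty$-functions. For $f,g\in\mathcal{A}$, $\Gamma(f,g)(x):=\frac12\big(\mathcal{L}(fg)-f\mathcal{L}g-g\mathcal{L}f\big)(x)=\frac12\sum_{y\in E}(f(y)-f(x))(g(y)-g(x))Q(x,y)$, and $\Gamma f:=\Gamma(f,f)$. $\Gamma$-curvature bounded below by $\rho\in\mathbb{R}$ means: $(\Gamma P_tf)^{1/2}(x)\le e^{-\rho t}P_t\big((\Gamma f)^{1/2}\big)(x)$ for every $f\in\mathcal{A}$, $x\in E$, $t>0$. *)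

theory Defs
  imports "HOL-Probability.Probability"
begin

section \<open>Extended-valued functions and norms\<close>

definition exp_ereal :: "ereal \<Rightarrow> ereal" where
  "exp_ereal z = (if z = \<infinity> then \<infinity> else if z = -\<infinity> then 0 else ereal (exp (real_of_ereal z)))"

definition sqrt_ennreal :: "ennreal \<Rightarrow> ennreal" where
  "sqrt_ennreal z = (if z = \<infinity> then \<infinity> else ennreal (sqrt (enn2real z)))"

definition sup_norm :: "('a \<Rightarrow> real) \<Rightarrow> ennreal" where
  "sup_norm g = (SUP x. ennreal \<bar>g x\<bar>)"

definition Lip_norm :: "('a \<Rightarrow> 'a \<Rightarrow> real) \<Rightarrow> ('a \<Rightarrow> real) \<Rightarrow> ennreal" where
  "Lip_norm d f = (SUP (x, y)\<in>{(x, y). x \<noteq> y}. ennreal (\<bar>f x - f y\<bar> / d x y))"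

definition Lip :: "('a \<Rightarrow> 'a \<Rightarrow> real) \<Rightarrow> ('a \<Rightarrow> real) set" where
  "Lip d = {f. Lip_norm d f < \<infinity>}"

definition trivial_metric :: "'a \<Rightarrow> 'a \<Rightarrow> real" where
  "trivial_metric x y = (if x = y then 0 else 1)"

definition smooth :: "(real \<Rightarrow> real) \<Rightarrow> bool" where
  "smooth \<phi> \<longleftrightarrow> (\<forall>n x. ((deriv ^^ n) \<phi>) differentiable (at x))"


section \<open>Transition rates\<close>

text \<open>Only the off-diagonal entries of a rate matrix \<open>Q\<close> carry meaning. No condition is imposed
  on \<open>Q x x\<close>, and every formula below gives that entry weight zero.\<close>

definition exit_rate :: "('a \<Rightarrow> 'a \<Rightarrow> real) \<Rightarrow> 'a \<Rightarrow> real" where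
  "exit_rate Q x = (\<Sum>\<^sub>\<infinity>y\<in>- {x}. Q x y)"

definition stable_rates :: "('a \<Rightarrow> 'a \<Rightarrow> real) \<Rightarrow> bool" where
  "stable_rates Q \<longleftrightarrow>
     (\<forall>x y. x \<noteq> y \<longrightarrow> 0 \<le> Q x y) \<and> (\<forall>x. Q x summable_on (- {x}))"

text \<open>Sub-stochastic standard transition functions.\<close>

definition transition_function :: "(real \<Rightarrow> 'a \<Rightarrow> 'a \<Rightarrow> real) \<Rightarrow> bool" where
  "transition_function p \<longleftrightarrow>
     (\<forall>t\<ge>0. \<forall>x y. 0 \<le> p t x y) \<and>
     (\<forall>t\<ge>0. \<forall>x. p t x summable_on UNIV \<and> (\<Sum>\<^sub>\<infinity>y. p t x y) \<le> 1) \<and>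
     (\<forall>x y. p 0 x y = (if x = y then 1 else 0)) \<and>
     (\<forall>s\<ge>0. \<forall>t\<ge>0. \<forall>x y. ((\<lambda>z. p s x z * p t z y) has_sum p (s + t) x y) UNIV) \<and>
     (\<forall>x. ((\<lambda>t. p t x x) \<longlongrightarrow> 1) (at_right 0))"

text \<open>The transition function \<open>p\<close> has derivative \<open>Q\<close> at time \<open>0\<close>. The rates are conservative: the
  rate of leaving \<open>x\<close>, which is minus the derivative of \<open>p\<^sub>t(x,x)\<close> at \<open>0\<close>, is the sum of the rates
  of jumping from \<open>x\<close> to the other states.\<close>

definition has_rates :: "(real \<Rightarrow> 'a \<Rightarrow> 'a \<Rightarrow> real) \<Rightarrow> ('a \<Rightarrow> 'a \<Rightarrow> real) \<Rightarrow> bool" where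
  "has_rates p Q \<longleftrightarrow>
     (\<forall>x y. x \<noteq> y \<longrightarrow> ((\<lambda>h. p h x y / h) \<longlongrightarrow> Q x y) (at_right 0)) \<and>
     (\<forall>x. ((\<lambda>h. (1 - p h x x) / h) \<longlongrightarrow> exit_rate Q x) (at_right 0))"

definition regular_rates :: "('a \<Rightarrow> 'a \<Rightarrow> real) \<Rightarrow> bool" where
  "regular_rates Q \<longleftrightarrow>
     stable_rates Q \<and>
     (\<forall>p p'. transition_function p \<longrightarrow> has_rates p Q \<longrightarrow>
             transition_function p' \<longrightarrow> has_rates p' Q \<longrightarrow>
             (\<forall>t\<ge>0. p t = p' t))"


section \<open>Regular non-explosive continuous-time Markov chains\<close>

text \<open>A right-continuous path (for the discrete topology on the state space) with only finitely many
  jumps up to any finite time.\<close>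

definition nonexplosive_path :: "(real \<Rightarrow> 'a) \<Rightarrow> bool" where
  "nonexplosive_path \<omega> \<longleftrightarrow>
     (\<forall>t\<ge>0. \<forall>\<^sub>F s in at_right t. \<omega> s = \<omega> t) \<and>
     (\<forall>T. finite {t. 0 < t \<and> t \<le> T \<and> \<not> (\<forall>\<^sub>F s in at_left t. \<omega> s = \<omega> t)})"

definition trans_prob ::
  "('a \<Rightarrow> 'w measure) \<Rightarrow> (real \<Rightarrow> 'w \<Rightarrow> 'a) \<Rightarrow> real \<Rightarrow> 'a \<Rightarrow> 'a \<Rightarrow> real" where
  "trans_prob Pr X t x y = measure (Pr x) {\<omega> \<in> space (Pr x). X t \<omega> = y}"

text \<open>\<open>Pr x\<close> is the law of the chain started at \<open>x\<close>. In the Markov property, the values of the chain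
  at finitely many times before the present time \<open>s\<close> are prescribed by \<open>\<eta>\<close>.\<close>

locale regular_markov_chain =
  fixes Pr :: "'a::countable \<Rightarrow> 'w measure"
    and X :: "real \<Rightarrow> 'w \<Rightarrow> 'a"
    and Q :: "'a \<Rightarrow> 'a \<Rightarrow> real"
  assumes prob_space: "prob_space (Pr x)"
    and measurable: "0 \<le> t \<Longrightarrow> X t \<in> measurable (Pr x) (count_space UNIV)"
    and start: "AE \<omega> in Pr x. X 0 \<omega> = x"
    and markov: "\<lbrakk>0 \<le> s; 0 \<le> t; finite I; I \<subseteq> {0..s}\<rbrakk> \<Longrightarrow>
        measure (Pr x) {\<omega> \<in> space (Pr x). (\<forall>i\<in>I. X i \<omega> = \<eta> i) \<and> X s \<omega> = y \<and> X (s + t) \<omega> = z} =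
        measure (Pr x) {\<omega> \<in> space (Pr x). (\<forall>i\<in>I. X i \<omega> = \<eta> i) \<and> X s \<omega> = y} * trans_prob Pr X t y z"
    and rates: "has_rates (trans_prob Pr X) Q"
    and regular: "regular_rates Q"
    and nonexplosive: "AE \<omega> in Pr x. nonexplosive_path (\<lambda>t. X t \<omega>)"


section \<open>Generator, semigroup and curvature\<close>

definition generator :: "('a \<Rightarrow> 'a \<Rightarrow> real) \<Rightarrow> ('a \<Rightarrow> real) \<Rightarrow> 'a \<Rightarrow> real" where
  "generator Q f x = (\<Sum>\<^sub>\<infinity>y. (f y - f x) * Q x y)"

definition semigroup_op ::
  "('a \<Rightarrow> 'w measure) \<Rightarrow> (real \<Rightarrow> 'w \<Rightarrow> 'a) \<Rightarrow> real \<Rightarrow> ('a \<Rightarrow> real) \<Rightarrow> 'a \<Rightarrow> real" where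
  "semigroup_op Pr X t f x = (\<integral>\<omega>. f (X t \<omega>) \<partial>Pr x)"

definition Gam2 :: "('a \<Rightarrow> 'a \<Rightarrow> real) \<Rightarrow> ('a \<Rightarrow> real) \<Rightarrow> ('a \<Rightarrow> real) \<Rightarrow> 'a \<Rightarrow> real" where
  "Gam2 Q f g x =
     1 / 2 * (generator Q (\<lambda>z. f z * g z) x - f x * generator Q g x - g x * generator Q f x)"

abbreviation Gam :: "('a \<Rightarrow> 'a \<Rightarrow> real) \<Rightarrow> ('a \<Rightarrow> real) \<Rightarrow> 'a \<Rightarrow> real" where
  "Gam Q f \<equiv> Gam2 Q f f"

text \<open>Stability under the generator and the semigroup includes that these are well defined on the
  algebra: the series converge absolutely (for real series, the meaning of \<open>summable_on\<close>), and the
  expectations exist.\<close>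

locale admissible_algebra =
  fixes Pr :: "'a::countable \<Rightarrow> 'w measure"
    and X :: "real \<Rightarrow> 'w \<Rightarrow> 'a"
    and Q :: "'a \<Rightarrow> 'a \<Rightarrow> real"
    and A :: "('a \<Rightarrow> real) set"
  assumes bounded_mem: "bounded (range f) \<Longrightarrow> f \<in> A"
    and add_mem: "\<lbrakk>f \<in> A; g \<in> A\<rbrakk> \<Longrightarrow> (\<lambda>x. f x + g x) \<in> A"
    and scale_mem: "f \<in> A \<Longrightarrow> (\<lambda>x. c * f x) \<in> A"
    and mult_mem: "\<lbrakk>f \<in> A; g \<in> A\<rbrakk> \<Longrightarrow> (\<lambda>x. f x * g x) \<in> A"
    and generator_summable: "f \<in> A \<Longrightarrow> (\<lambda>y. (f y - f x) * Q x y) summable_on UNIV"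
    and generator_mem: "f \<in> A \<Longrightarrow> generator Q f \<in> A"
    and semigroup_integrable: "\<lbrakk>f \<in> A; 0 \<le> t\<rbrakk> \<Longrightarrow> integrable (Pr x) (\<lambda>\<omega>. f (X t \<omega>))"
    and semigroup_mem: "\<lbrakk>f \<in> A; 0 \<le> t\<rbrakk> \<Longrightarrow> semigroup_op Pr X t f \<in> A"
    and smooth_mem: "\<lbrakk>f \<in> A; smooth \<phi>\<rbrakk> \<Longrightarrow> (\<lambda>x. \<phi> (f x)) \<in> A"
begin

lemma Gam2_has_sum:
  assumes f: "f \<in> A" and g: "g \<in> A"
  shows "((\<lambda>y. 1 / 2 * ((f y - f x) * (g y - g x) * Q x y)) has_sum Gam2 Q f g x) UNIV"
proof -
  have gen: "((\<lambda>y. (h y - h x) * Q x y) has_sum generator Q h x) UNIV" if "h \<in> A" for h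
    unfolding generator_def using generator_summable[OF that] by (rule has_sum_infsum)
  have "((\<lambda>y. 1 / 2 * (((f y * g y - f x * g x) * Q x y + (- f x) * ((g y - g x) * Q x y))
            + (- g x) * ((f y - f x) * Q x y))) has_sum
        1 / 2 * ((generator Q (\<lambda>z. f z * g z) x + (- f x) * generator Q g x)
            + (- g x) * generator Q f x)) UNIV"
    by (intro has_sum_cmult_right has_sum_add gen[OF mult_mem[OF f g]] gen[OF g] gen[OF f])
  then show ?thesis
    by (simp add: Gam2_def algebra_simps)
qed

end

definition Gamma_curvature_ge ::
  "('a \<Rightarrow> 'w measure) \<Rightarrow> (real \<Rightarrow> 'w \<Rightarrow> 'a) \<Rightarrow> ('a \<Rightarrow> 'a \<Rightarrow> real) \<Rightarrow> ('a \<Rightarrow> real) set \<Rightarrow> real \<Rightarrow> bool"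
where
  "Gamma_curvature_ge Pr X Q A \<rho> \<longleftrightarrow>
     (\<forall>f\<in>A. \<forall>x. \<forall>t>0.
        sqrt (Gam Q (semigroup_op Pr X t f) x)
          \<le> exp (- \<rho> * t) * semigroup_op Pr X t (\<lambda>z. sqrt (Gam Q f z)) x)"


section \<open>The deviation function\<close>

definition L_const :: "real \<Rightarrow> real \<Rightarrow> real" where
  "L_const t \<rho> = (if \<rho> = 0 then t else (1 - exp (- 2 * \<rho> * t)) / (2 * \<rho>))"

text \<open>The quotients are \<open>0\<close> by \<open>a / 0 = 0\<close> when \<open>y = x\<close> or \<open>f\<close> is constant. In both cases the factor
  \<open>(f y - f x)\<^sup>2\<close> vanishes anyway.\<close>

definition psi ::
  "('a \<Rightarrow> 'a \<Rightarrow> real) \<Rightarrow> ('a \<Rightarrow> 'a \<Rightarrow> real) \<Rightarrow> real \<Rightarrow> ('a \<Rightarrow> real) \<Rightarrow> real \<Rightarrow> real \<Rightarrow> ennreal"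
where
  "psi d Q \<rho> f t \<theta> =
     ennreal (sqrt 2 * L_const t \<rho>) * sqrt_ennreal (sup_norm (Gam Q f)) *
     sqrt_ennreal (SUP x. \<Sum>\<^sub>\<infinity>y. ennreal
       ((f y - f x)\<^sup>2 *
        ((exp (\<theta> * enn2real (Lip_norm d f) * d x y) - 1) / (enn2real (Lip_norm d f) * d x y))\<^sup>2 *
        Q x y))"

text \<open>If \<open>psi\<close> is infinite at every positive argument, the supremum is \<open>0\<close>.\<close>

definition M_const ::
  "('a \<Rightarrow> 'a \<Rightarrow> real) \<Rightarrow> ('a \<Rightarrow> 'a \<Rightarrow> real) \<Rightarrow> real \<Rightarrow> ('a \<Rightarrow> real) \<Rightarrow> real \<Rightarrow> ennreal" where
  "M_const d Q \<rho> f t = (SUP \<theta>\<in>{\<theta>. 0 < \<theta> \<and> psi d Q \<rho> f t \<theta> < \<infinity>}. ennreal \<theta>)"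

end

theory Submission
  imports Defs
begin

text \<open>Herbst's argument for the semigroup. Differentiating \<open>s \<mapsto> P\<^sub>s (P\<^sub>t\<^sub>-\<^sub>s g \<cdot> P\<^sub>t\<^sub>-\<^sub>s h)\<close> gives
  \<open>Cov (g (X\<^sub>t)) (h (X\<^sub>t)) = 2 \<integral>\<^sub>0\<^sup>t P\<^sub>s (\<Gamma>(P\<^sub>t\<^sub>-\<^sub>s g, P\<^sub>t\<^sub>-\<^sub>s h)) ds\<close>. With Cauchy-Schwarz, the curvature bound and
  \<open>h = exp (\<lambda> g)\<close>, this is at most \<open>\<psi>(\<lambda>) P\<^sub>t (exp (\<lambda> g))\<close>, a differential inequality for the logarithm of
  the moment generating function; Chernoff's bound then gives the deviation inequality.
  Only bounded \<open>g\<close> are treated this way, and \<open>f\<close> is reached through its truncations, which are contractions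
  of \<open>f\<close> and so do not increase \<open>\<Gamma>\<close>. The interchange of derivative and \<open>P\<^sub>s\<close> needs the exit rate to be
  \<open>P\<^sub>s\<close>-integrable, which follows from the stability of the algebra under the generator.\<close>

section \<open>Real functions and discrete distributions\<close>

text \<open>The constants: each of the two curvature bounds contributes
  \<open>exp (- \<rho> * (t - s))\<close>, and the product of these factors integrates over [0, t]
  to \<open>L_const t \<rho>\<close>. The 1/2 in \<Gamma> gives sqrt \<Gamma>(exp(\<lambda> g)) a
  factor 1 / sqrt 2, which turns the 2 of the covariance identity into the sqrt 2 of
  \<open>psi\<close>. Both differential inequalities are one-sided: the rates are right limits at
  time 0, and \<open>psi\<close> is monotone but not known to be continuous. So both times a
  continuous function is compared with its bound by a Dini criterion, which asks only for some point
  further to the right. The rates may be unbounded, so the image of a bounded function under the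
  semigroup changes in time at a speed that depends on the state, at most a constant times the exit
  rate. Estimates that are averaged over the state at time s must therefore stay linear in the exit
  rate, of which only the first moment is controlled.\<close>

lemma dini_le:
  fixes g :: "real \<Rightarrow> real"
  assumes "a \<le> b" and cont: "continuous_on {a..b} g"
    and dini: "\<And>s \<epsilon>. \<lbrakk>a \<le> s; s < b; 0 < \<epsilon>\<rbrakk> \<Longrightarrow> \<exists>u. s < u \<and> u \<le> b \<and> g u \<le> g s + \<epsilon> * (u - s)"
  shows "g b \<le> g a"
proof (rule ccontr)
  assume "\<not> g b \<le> g a"
  with \<open>a \<le> b\<close> have "a < b" "g a < g b" by (cases "a = b"; auto)+
  then have "0 < (g b - g a) / (b - a)" by simp
  then obtain \<epsilon> where "0 < \<epsilon>" "\<epsilon> < (g b - g a) / (b - a)"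
    using dense by blast
  then have \<epsilon>: "0 < \<epsilon>" "\<epsilon> * (b - a) < g b - g a"
    using \<open>a < b\<close> by (simp_all add: pos_less_divide_eq)
  \<comment> \<open>\<open>S\<close> collects the points up to which \<open>g\<close> has grown from
    \<open>a\<close> with slope at most \<epsilon>. It contains \<open>a\<close> but not
    \<open>b\<close>, as \<epsilon> lies below the mean slope; from its largest point the hypothesis
    leads to a further point of \<open>S\<close>.\<close>
  define k where "k u = g u - g a - \<epsilon> * (u - a)" for u
  define S where "S = {u \<in> {a..b}. k u \<le> 0}"
  have "continuous_on {a..b} k"
    unfolding k_def by (intro continuous_intros cont)
  then have "closed S"
    unfolding S_def by (intro continuous_on_closed_Collect_le) auto
  moreover have "S \<noteq> {}" "bdd_above S"
    using \<open>a < b\<close> by (auto simp: S_def k_def intro!: bdd_aboveI[of _ b] exI[of _ a])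
  ultimately have c: "Sup S \<in> S"
    by (intro closed_contains_Sup)
  define c where "c = Sup S"
  have "c \<noteq> b" using c \<epsilon> by (auto simp: S_def k_def c_def)
  with c have "a \<le> c" "c < b" "k c \<le> 0" by (auto simp: S_def c_def)
  then obtain u where u: "c < u" "u \<le> b" "g u \<le> g c + \<epsilon> * (u - c)"
    using dini \<epsilon> by blast
  then have "k u \<le> 0" using \<open>k c \<le> 0\<close> by (simp add: k_def algebra_simps)
  then have "u \<in> S" using u \<open>a \<le> c\<close> by (simp add: S_def)
  then show False using u \<open>bdd_above S\<close> by (auto simp: c_def dest: cSup_upper)
qed

lemma integrable_pmf_bounded:
  fixes g :: "'a \<Rightarrow> real"
  assumes "\<And>z. \<bar>g z\<bar> \<le> B"
  shows "integrable (measure_pmf p) g"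
  by (rule measure_pmf.integrable_const_bound[where B = B]) (use assms in auto)

lemma expectation_pmf_bounded:
  fixes g :: "'a \<Rightarrow> real"
  assumes "\<And>z. \<bar>g z\<bar> \<le> B"
  shows "\<bar>measure_pmf.expectation p g\<bar> \<le> B"
proof -
  have "\<bar>measure_pmf.expectation p g\<bar> \<le> measure_pmf.expectation p (\<lambda>_. B)"
    using assms by (intro order_trans[OF integral_abs_bound] integral_mono
        integrable_abs integrable_pmf_bounded[OF assms]) auto
  then show ?thesis by simp
qed

text \<open>An integrand vanishing at \<open>x\<close> sees only the mass off \<open>x\<close>. For
  the law of the chain shortly after a start in \<open>x\<close>, this mass is of the order of the
  elapsed time.\<close>

lemma expectation_pmf_atom_zero:
  fixes g :: "'a \<Rightarrow> real"
  assumes g: "\<And>z. \<bar>g z\<bar> \<le> B" and "g x = 0"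
  shows "\<bar>measure_pmf.expectation p g\<bar> \<le> B * (1 - pmf p x)"
proof -
  have B: "0 \<le> B" using g[of x] by linarith
  have "\<bar>measure_pmf.expectation p g\<bar> \<le> measure_pmf.expectation p (\<lambda>z. B * indicator (- {x}) z)"
    using assms B by (intro order_trans[OF integral_abs_bound] integral_mono
        integrable_abs integrable_pmf_bounded[OF g] integrable_pmf_bounded[of _ B])
      (auto simp: indicator_def)
  also have "\<dots> = B * measure_pmf.prob p (- {x})" by simp
  also have "measure_pmf.prob p (- {x}) = 1 - pmf p x"
    using measure_pmf.prob_compl[of "{x}" p] by (simp add: Compl_eq_Diff_UNIV measure_pmf_single)
  finally show ?thesis .
qed

lemma expectation_bind_pmf:
  fixes g :: "'b \<Rightarrow> real"
  assumes "\<And>z. \<bar>g z\<bar> \<le> B"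
  shows "measure_pmf.expectation (bind_pmf p k) g =
    measure_pmf.expectation p (\<lambda>x. measure_pmf.expectation (k x) g)"
  unfolding measure_pmf_bind
  by (rule integral_bind[where K = "count_space UNIV" and B = B and B' = 1])
     (use assms in \<open>auto simp: measure_subprob measure_pmf.emeasure_space_1[simplified]\<close>)

lemma finite_to_nat_less: "finite {z::'a::countable. to_nat z < N}"
  by (rule finite_imageD[of to_nat]) (auto intro: finite_subset[of _ "{..<N}"] inj_on_subset[OF inj_to_nat])

text \<open>Signs are fixed one after the other along the enumeration: a new state changes the
  off-diagonal form by its sign times a number determined by earlier signs, so one of the two signs
  makes this change nonpositive.\<close>

lemma greedy_signs:
  fixes a :: "'a::countable \<Rightarrow> 'a \<Rightarrow> real"
  obtains e :: "'a \<Rightarrow> real" where "\<And>y. e y \<in> {-1, 1}"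
    "\<And>N. (\<Sum>y | to_nat y < N. \<Sum>z | to_nat z < N. if z = y then 0 else a y z * (e y * e z)) \<le> 0"
proof -
  \<comment> \<open>Collects, in both orders, the coefficients linking \<open>y\<close> to earlier
    states, so that \<open>e y * c y e\<close> is what \<open>y\<close> adds to the form. It depends
    on earlier signs only, which justifies the well-founded choice.\<close>
  define c where "c y e = (\<Sum>z | to_nat z < to_nat y. (a y z + a z y) * e z)" for y and e :: "'a \<Rightarrow> real"
  have fin: "finite {z::'a. to_nat z < N}" for N by (rule finite_to_nat_less)
  have "\<exists>e. \<forall>y. e y \<in> {-1, 1} \<and> e y * c y e \<le> (0::real)"
  proof (rule dependent_wf_choice[of "inv_image less_than to_nat"])
    fix f g :: "'a \<Rightarrow> real" and x r assume "\<And>z. (z, x) \<in> inv_image less_than to_nat \<Longrightarrow> f z = g z"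
    then have "c x f = c x g" by (auto simp: c_def intro!: sum.cong)
    then show "(r \<in> {-1, 1} \<and> r * c x f \<le> 0) = (r \<in> {-1, 1} \<and> r * c x g \<le> 0)" by simp
  next
    fix x and f :: "'a \<Rightarrow> real"
    show "\<exists>r. r \<in> {-1, 1} \<and> r * c x f \<le> 0"
      by (cases "c x f \<le> 0") (auto intro: exI[of _ 1] exI[of _ "-1"])
  qed simp
  then obtain e where e: "\<And>y. e y \<in> {-1, 1}" "\<And>y. e y * c y e \<le> 0" by blast
  define b where "b y z = (if z = y then 0 else a y z * (e y * e z))" for y z
  have "(\<Sum>y | to_nat y < N. \<Sum>z | to_nat z < N. b y z) \<le> 0" for N
  proof (induction N)
    case (Suc N)
    let ?F = "{z::'a. to_nat z < N}"
    show ?case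
    proof (cases "\<exists>y::'a. to_nat y = N")
      case True
      then obtain y :: 'a where y: "to_nat y = N" by blast
      have F: "{z::'a. to_nat z < Suc N} = insert y ?F"
        using y by (auto simp: less_Suc_eq)
      have "(\<Sum>u\<in>insert y ?F. \<Sum>z\<in>insert y ?F. b u z) =
          (\<Sum>u\<in>?F. \<Sum>z\<in>?F. b u z) + ((\<Sum>z\<in>?F. b y z) + (\<Sum>z\<in>?F. b z y))"
        using fin[of N] y by (simp add: sum.distrib b_def)
      also have "(\<Sum>z\<in>?F. b y z) + (\<Sum>z\<in>?F. b z y) = e y * c y e"
        unfolding c_def y sum_distrib_left sum.distrib[symmetric]
        by (rule sum.cong) (use y in \<open>auto simp: b_def algebra_simps\<close>)
      finally show ?thesis using Suc e(2)[of y] by (simp add: F)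
    next
      \<comment> \<open>\<open>to_nat\<close> need not be onto; if it skips \<open>N\<close>, the
        segment does not grow.\<close>
      case False
      then have "{z::'a. to_nat z < Suc N} = ?F"
        by (auto simp: less_Suc_eq)
      then show ?thesis using Suc by simp
    qed
  qed simp
  with e(1) show ?thesis unfolding b_def by (rule that)
qed

section \<open>Moment generating functions and Herbst's differential inequality\<close>

lemma abs_exp_minus_one_le: "\<bar>exp x - 1\<bar> \<le> \<bar>x\<bar> * exp \<bar>x\<bar>" for x :: real
proof (cases "0 \<le> x")
  case True
  have "1 - x \<le> exp (- x)" using exp_ge_add_one_self[of "- x"] by simp
  then have "(1 - x) * exp x \<le> exp (- x) * exp x" by (intro mult_right_mono) auto
  then show ?thesis using True by (simp add: exp_minus algebra_simps)
next
  case False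
  then have "exp x < 1" by simp
  then have "\<bar>exp x - 1\<bar> \<le> \<bar>x\<bar>" using exp_ge_add_one_self[of x] by linarith
  also have "\<dots> \<le> \<bar>x\<bar> * exp \<bar>x\<bar>" by (simp add: mult_le_cancel_left1)
  finally show ?thesis .
qed

lemma exp_bounded:
  fixes g :: "'a \<Rightarrow> real"
  assumes "\<And>z. \<bar>g z\<bar> \<le> B"
  shows "\<bar>exp (s * g z)\<bar> \<le> exp (\<bar>s\<bar> * B)"
proof -
  have "s * g z \<le> \<bar>s * g z\<bar>" by simp
  also have "\<dots> \<le> \<bar>s\<bar> * B" unfolding abs_mult using assms by (intro mult_left_mono) auto
  finally show ?thesis by simp
qed

lemma integrable_pmf_exp:
  fixes g :: "'a \<Rightarrow> real"
  assumes "\<And>z. \<bar>g z\<bar> \<le> B"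
  shows "integrable (measure_pmf p) (\<lambda>z. exp (s * g z))"
  by (rule integrable_pmf_bounded[where B = "exp (\<bar>s\<bar> * B)"]) (rule exp_bounded[OF assms])

text \<open>Dominated convergence along null sequences: such a sequence is bounded, and for bounded
  shifts the difference quotients have a constant majorant.\<close>

lemma moment_generating_deriv:
  fixes g :: "'a \<Rightarrow> real"
  assumes g: "\<And>z. \<bar>g z\<bar> \<le> B"
  shows "((\<lambda>s. measure_pmf.expectation p (\<lambda>z. exp (s * g z))) has_real_derivative
    measure_pmf.expectation p (\<lambda>z. g z * exp (s * g z))) (at s)"
  unfolding DERIV_def LIMSEQ_SEQ_conv[symmetric]
proof (intro allI impI)
  fix S :: "nat \<Rightarrow> real" assume S: "(\<forall>n. S n \<noteq> 0) \<and> S \<longlonglongrightarrow> 0"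
  then obtain D where D: "\<And>n. \<bar>S n\<bar> \<le> D"
    using convergent_imp_Bseq[of S] by (auto simp: convergent_def Bseq_def)
  have B: "0 \<le> B" using order_trans[OF abs_ge_zero g] .
  have quot: "\<bar>(exp ((s + S n) * g z) - exp (s * g z)) / S n\<bar> \<le> exp (\<bar>s\<bar> * B) * (B * exp (D * B))" for n z
  proof -
    have le: "\<bar>S n\<bar> * \<bar>g z\<bar> \<le> D * B"
      using D[of n] g[of z] by (intro mult_mono) auto
    have eq: "(exp ((s + S n) * g z) - exp (s * g z)) / S n = exp (s * g z) * ((exp (S n * g z) - 1) / S n)"
      by (simp add: exp_add distrib_right right_diff_distrib)
    have "\<bar>(exp ((s + S n) * g z) - exp (s * g z)) / S n\<bar>
        = \<bar>exp (s * g z)\<bar> * (\<bar>exp (S n * g z) - 1\<bar> / \<bar>S n\<bar>)"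
      unfolding eq abs_mult abs_divide ..
    also have "\<dots> \<le> exp (\<bar>s\<bar> * B) * (B * exp (D * B))"
    proof (rule mult_mono)
      have "\<bar>exp (S n * g z) - 1\<bar> / \<bar>S n\<bar> \<le> (\<bar>S n * g z\<bar> * exp \<bar>S n * g z\<bar>) / \<bar>S n\<bar>"
        by (intro divide_right_mono abs_exp_minus_one_le) auto
      also have "\<dots> = \<bar>g z\<bar> * exp (\<bar>S n\<bar> * \<bar>g z\<bar>)"
        using S by (simp add: abs_mult)
      also have "\<dots> \<le> B * exp (D * B)"
        using le g[of z] by (intro mult_mono) auto
      finally show "\<bar>exp (S n * g z) - 1\<bar> / \<bar>S n\<bar> \<le> B * exp (D * B)" .
    qed (use exp_bounded[of g B s z, OF g] in auto)
    finally show ?thesis .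
  qed
  have "(\<lambda>n. measure_pmf.expectation p (\<lambda>z. (exp ((s + S n) * g z) - exp (s * g z)) / S n))
      \<longlonglongrightarrow> measure_pmf.expectation p (\<lambda>z. g z * exp (s * g z))"
  proof (rule integral_dominated_convergence)
    show "AE z in measure_pmf p. (\<lambda>n. (exp ((s + S n) * g z) - exp (s * g z)) / S n)
        \<longlonglongrightarrow> g z * exp (s * g z)"
    proof (rule AE_I2)
      fix z
      have "((\<lambda>s. exp (s * g z)) has_real_derivative g z * exp (s * g z)) (at s)"
        by (auto intro!: derivative_eq_intros)
      then show "(\<lambda>n. (exp ((s + S n) * g z) - exp (s * g z)) / S n) \<longlonglongrightarrow> g z * exp (s * g z)"
        unfolding DERIV_def LIMSEQ_SEQ_conv[symmetric] using S by auto
    qed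
    show "AE z in measure_pmf p. norm ((exp ((s + S n) * g z) - exp (s * g z)) / S n)
        \<le> exp (\<bar>s\<bar> * B) * (B * exp (D * B))" for n
      using quot by (intro AE_I2) simp
  qed auto
  moreover have "measure_pmf.expectation p (\<lambda>z. (exp ((s + S n) * g z) - exp (s * g z)) / S n)
      = (measure_pmf.expectation p (\<lambda>z. exp ((s + S n) * g z))
        - measure_pmf.expectation p (\<lambda>z. exp (s * g z))) / S n" for n
    by (simp add: Bochner_Integration.integral_diff[OF integrable_pmf_exp[OF g] integrable_pmf_exp[OF g]])
  ultimately show "(\<lambda>n. (measure_pmf.expectation p (\<lambda>z. exp ((s + S n) * g z))
        - measure_pmf.expectation p (\<lambda>z. exp (s * g z))) / S n)
      \<longlonglongrightarrow> measure_pmf.expectation p (\<lambda>z. g z * exp (s * g z))"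
    by (simp only:)
qed

lemma set_integrable_mono_on:
  fixes \<psi> :: "real \<Rightarrow> real"
  assumes "mono_on {a..b} \<psi>"
  shows "set_integrable lborel {a..b} \<psi>"
proof (cases "a \<le> b")
  case True
  have "set_borel_measurable lborel {a..b} \<psi>"
    using borel_measurable_mono_on_fnc[OF assms]
    by (simp add: set_borel_measurable_def borel_measurable_restrict_space_iff scaleR_conv_of_real)
  moreover have "norm (\<psi> x) \<le> max \<bar>\<psi> a\<bar> \<bar>\<psi> b\<bar>" if "x \<in> {a..b}" for x
    using mono_onD[OF assms, of a x] mono_onD[OF assms, of x b] that by auto
  ultimately show ?thesis
    unfolding set_integrable_def set_borel_measurable_def
    by (intro integrableI_bounded_set[where A = "{a..b}" and B = "max \<bar>\<psi> a\<bar> \<bar>\<psi> b\<bar>"])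
       (use True in \<open>auto simp: indicator_def\<close>)
qed (simp add: set_integrable_def)

text \<open>The logarithmic derivative of \<open>F\<close> at \<open>s\<close> is the mean of
  \<open>g\<close> under the law tilted by \<open>exp (s * g z)\<close>, and \<open>cov\<close>
  bounds its excess over \<open>m\<close> by \<open>\<psi> s\<close>. Hence
  \<open>ln (F s) - s * m\<close> minus the integral of \<psi> does not increase from its value 0 at
  \<open>s = 0\<close>.\<close>

lemma herbst:
  fixes p :: "'a pmf" and g :: "'a \<Rightarrow> real" and \<psi> :: "real \<Rightarrow> real" and \<theta> :: real
  defines "F \<equiv> \<lambda>s. measure_pmf.expectation p (\<lambda>z. exp (s * g z))"
    and "m \<equiv> measure_pmf.expectation p g"
  assumes g: "\<And>z. \<bar>g z\<bar> \<le> B" and "0 \<le> \<theta>" and mono: "mono_on {0..\<theta>} \<psi>"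
    and cov: "\<And>s. \<lbrakk>0 \<le> s; s < \<theta>\<rbrakk> \<Longrightarrow>
      measure_pmf.expectation p (\<lambda>z. g z * exp (s * g z)) - m * F s \<le> \<psi> s * F s"
  shows "F \<theta> \<le> exp (\<theta> * m + (LBINT \<tau>:{0..\<theta>}. \<psi> \<tau>))"
proof -
  have F_pos: "0 < F s" for s
  proof -
    have "\<bar>s * g z\<bar> \<le> \<bar>s\<bar> * B" for z unfolding abs_mult using g by (intro mult_left_mono) auto
    then have "exp (- \<bar>s\<bar> * B) \<le> exp (s * g z)" for z by (simp add: abs_le_iff) (metis minus_le_iff)
    then have "measure_pmf.expectation p (\<lambda>_. exp (- \<bar>s\<bar> * B)) \<le> F s"
      unfolding F_def by (intro integral_mono integrable_pmf_exp[OF g]) auto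
    then show ?thesis by simp (meson exp_gt_zero less_le_trans)
  qed
  define I where "I s = integral {0..s} \<psi>" for s
  have int: "\<psi> integrable_on {a..b}" if "0 \<le> a" "b \<le> \<theta>" for a b
    using set_borel_integral_eq_integral(1)[OF set_integrable_mono_on[OF mono_on_subset[OF mono]]] that
    by simp
  \<comment> \<open>As \<psi> is nondecreasing, its value at the left end bounds the increment of
    \<open>I\<close> from below. This replaces a derivative of \<open>I\<close>, which may fail to
    exist.\<close>
  have I_step: "I s + (u - s) * \<psi> s \<le> I u" if "0 \<le> s" "s \<le> u" "u \<le> \<theta>" for s u
  proof -
    have "integral {s..u} (\<lambda>_. \<psi> s) \<le> integral {s..u} \<psi>"
      using that by (intro integral_le int) (auto intro!: mono_onD[OF mono])
    moreover have "I u = I s + integral {s..u} \<psi>"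
      unfolding I_def using that
      by (intro Henstock_Kurzweil_Integration.integral_combine[symmetric] int) auto
    ultimately show ?thesis using that by simp
  qed
  have deriv: "((\<lambda>s. ln (F s) - s * m) has_real_derivative
      measure_pmf.expectation p (\<lambda>z. g z * exp (s * g z)) / F s - m) (at s)" for s
    using moment_generating_deriv[of g B p s, OF g] F_pos[of s] unfolding F_def
    by (auto intro!: derivative_eq_intros)
  have "(ln (F \<theta>) - \<theta> * m) - I \<theta> \<le> (ln (F 0) - 0 * m) - I 0"
  proof (rule dini_le[OF \<open>0 \<le> \<theta>\<close>])
    show "continuous_on {0..\<theta>} (\<lambda>s. ln (F s) - s * m - I s)"
    proof (rule continuous_on_diff)
      show "continuous_on {0..\<theta>} (\<lambda>s. ln (F s) - s * m)"
        by (rule DERIV_continuous_on) (rule has_field_derivative_at_within[OF deriv])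
      show "continuous_on {0..\<theta>} I"
        unfolding I_def by (rule indefinite_integral_continuous_1) (rule int; simp)
    qed
    fix s \<epsilon> :: real assume s: "0 \<le> s" "s < \<theta>" and "0 < \<epsilon>"
    \<comment> \<open>With \<open>Suc n\<close> the steps are positive and at most
      \<open>\<theta> - s\<close>, so \<open>s + h n\<close> stays in the interval.\<close>
    define h where "h n = (\<theta> - s) / real (Suc n)" for n
    have h: "0 < h n" "h n \<le> \<theta> - s" for n
      using s mult_left_mono[of 1 "real (Suc n)" "\<theta> - s"] by (auto simp: h_def pos_divide_le_eq)
    have h0: "h \<longlonglongrightarrow> 0" unfolding h_def by real_asymp
    define G where "G s = ln (F s) - s * m" for s
    have "(\<lambda>n. (G (s + h n) - G s) / h n)
        \<longlonglongrightarrow> measure_pmf.expectation p (\<lambda>z. g z * exp (s * g z)) / F s - m"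
      using deriv[of s] unfolding DERIV_def G_def[symmetric]
      by (rule filterlim_compose)
         (use h h0 in \<open>auto simp: filterlim_at less_imp_neq[symmetric] intro!: always_eventually\<close>)
    moreover have "measure_pmf.expectation p (\<lambda>z. g z * exp (s * g z)) / F s - m < \<psi> s + \<epsilon>"
    proof -
      have "measure_pmf.expectation p (\<lambda>z. g z * exp (s * g z)) / F s \<le> \<psi> s + m"
        using cov[OF s] F_pos[of s] by (simp add: pos_divide_le_eq algebra_simps)
      then show ?thesis using \<open>0 < \<epsilon>\<close> by linarith
    qed
    ultimately have "\<forall>\<^sub>F n in sequentially. (G (s + h n) - G s) / h n < \<psi> s + \<epsilon>"
      by (rule order_tendstoD)
    then obtain n where "(G (s + h n) - G s) / h n < \<psi> s + \<epsilon>"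
      by (auto dest!: eventually_happens)
    then have "G (s + h n) - G s < (\<psi> s + \<epsilon>) * h n"
      using h(1)[of n] by (simp add: pos_divide_less_eq)
    moreover have "I s + h n * \<psi> s \<le> I (s + h n)"
      using I_step[of s "s + h n"] s h[of n] by simp
    ultimately have "G (s + h n) - I (s + h n) \<le> G s - I s + \<epsilon> * (s + h n - s)"
      by (simp add: algebra_simps)
    then show "\<exists>u>s. u \<le> \<theta> \<and> ln (F u) - u * m - I u \<le> ln (F s) - s * m - I s + \<epsilon> * (u - s)"
      using h[of n] by (intro exI[of _ "s + h n"]) (auto simp: G_def)
  qed
  moreover have "F 0 = 1" by (simp add: F_def)
  moreover have "I 0 = 0" by (simp add: I_def)
  moreover have "I \<theta> = (LBINT \<tau>:{0..\<theta>}. \<psi> \<tau>)"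
    unfolding I_def by (rule set_borel_integral_eq_integral(2)[OF set_integrable_mono_on[OF mono], symmetric])
  ultimately have "ln (F \<theta>) \<le> \<theta> * m + (LBINT \<tau>:{0..\<theta>}. \<psi> \<tau>)" by simp
  then show ?thesis using F_pos[of \<theta>] by (metis exp_le_cancel_iff exp_ln)
qed

section \<open>Semigroups with given rates\<close>

text \<open>Only the laws at fixed times are kept, not the paths. As each \<open>K t x\<close> is a
  \<open>pmf\<close>, no mass is lost.\<close>

locale rate_kernel =
  fixes K :: "real \<Rightarrow> 'a::countable \<Rightarrow> 'a pmf" and Q :: "'a \<Rightarrow> 'a \<Rightarrow> real"
  assumes Q_nonneg: "x \<noteq> y \<Longrightarrow> 0 \<le> Q x y"
    and Q_summable: "Q x summable_on (- {x})"
    and K_0: "K 0 x = return_pmf x"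
    and K_add: "\<lbrakk>0 \<le> s; 0 \<le> t\<rbrakk> \<Longrightarrow> K (s + t) x = bind_pmf (K s x) (K t)"
    and rates: "has_rates (\<lambda>t x. pmf (K t x)) Q"
begin

abbreviation P :: "real \<Rightarrow> ('a \<Rightarrow> real) \<Rightarrow> 'a \<Rightarrow> real" where
  "P t g x \<equiv> measure_pmf.expectation (K t x) g"

abbreviation q :: "'a \<Rightarrow> real" where
  "q \<equiv> exit_rate Q"

lemma q_nonneg: "0 \<le> q x"
  unfolding exit_rate_def by (rule infsum_nonneg) (use Q_nonneg in auto)

text \<open>The rates describe only the limit at time 0, but the probability of being at the
  starting state is supermultiplicative in time: \<open>a h\<close> is at least
  \<open>a (h / n) ^ n\<close>, and Bernoulli's inequality carries the bound over to every
  \<open>h\<close>. Dominated convergence will need it uniformly in \<open>h\<close>.\<close>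

lemma holding_prob:
  assumes "0 \<le> h"
  shows "1 - pmf (K h x) x \<le> q x * h"
proof (cases "h = 0")
  case True
  then show ?thesis by (simp add: K_0)
next
  case False
  with assms have h: "0 < h" by simp
  define a where "a s = pmf (K s x) x" for s
  have mult: "a s * a u \<le> a (s + u)" if "0 \<le> s" "0 \<le> u" for s u
  proof -
    have "a s * a u = measure_pmf.expectation (K s x) (\<lambda>z. a u * indicator {x} z)"
      by (simp add: a_def measure_pmf_single)
    also have "\<dots> \<le> measure_pmf.expectation (K s x) (\<lambda>z. pmf (K u z) x)"
      by (intro integral_mono integrable_pmf_bounded[where B = 1])
         (auto simp: a_def indicator_def pmf_le_1)
    also have "\<dots> = a (s + u)" using that by (simp add: a_def K_add pmf_bind)
    finally show ?thesis .
  qed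
  have power: "a u ^ n \<le> a (real n * u)" if "0 \<le> u" for u n
  proof (induction n)
    case (Suc n)
    have "a u * a u ^ n \<le> a u * a (real n * u)"
      using Suc by (intro mult_left_mono) (auto simp: a_def)
    also have "\<dots> \<le> a (u + real n * u)" using that by (intro mult) auto
    finally show ?case by (simp add: algebra_simps)
  qed (simp add: a_def K_0)
  have "1 - a h \<le> q x * h + \<epsilon>" if "0 < \<epsilon>" for \<epsilon>
  proof -
    \<comment> \<open>The slack \<open>\<epsilon> / h\<close> becomes \<epsilon> after
      multiplication by \<open>h\<close>.\<close>
    define c where "c = q x + \<epsilon> / h"
    have c: "q x < c" using h that by (simp add: c_def)
    have seq: "(\<lambda>n. h / real n) \<longlonglongrightarrow> 0" by real_asymp
    have "((\<lambda>h. (1 - a h) / h) \<longlongrightarrow> q x) (at_right 0)"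
      using rates by (simp add: has_rates_def a_def)
    then have "\<forall>\<^sub>F s in at_right 0. (1 - a s) / s < c"
      using c by (rule order_tendstoD)
    moreover have "filterlim (\<lambda>n. h / real n) (at_right 0) sequentially"
      unfolding filterlim_at
      using seq eventually_gt_at_top[of 0] h by (auto elim!: eventually_mono simp: zero_less_divide_iff)
    ultimately have "\<forall>\<^sub>F n in sequentially. (1 - a (h / real n)) / (h / real n) < c"
      by (rule eventually_compose_filterlim)
    \<comment> \<open>Keeps the base \<open>1 - c * (h / n)\<close> positive, so that Bernoulli's
      inequality applies and powers are monotone.\<close>
    moreover have "\<forall>\<^sub>F n in sequentially. c * (h / real n) < 1"
      using tendsto_mult_right_zero[OF seq, of c] by (rule order_tendstoD) simp
    ultimately have "\<forall>\<^sub>F n in sequentially. 0 < n \<and> (1 - a (h / real n)) / (h / real n) < c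
        \<and> c * (h / real n) < 1"
      using eventually_gt_at_top[of 0] by eventually_elim auto
    then obtain n :: nat where n: "0 < n" "(1 - a (h / real n)) / (h / real n) < c"
        "c * (h / real n) < 1"
      by (auto dest!: eventually_happens)
    have lower: "1 - c * (h / real n) \<le> a (h / real n)"
      using n(1,2) h by (simp add: field_simps)
    have "1 - c * h = 1 + real n * (- (c * (h / real n)))"
      using n by simp
    also have "\<dots> \<le> (1 + - (c * (h / real n))) ^ n"
      using n by (intro Bernoulli_inequality) simp
    also have "\<dots> \<le> a (h / real n) ^ n"
      using lower n by (intro power_mono) auto
    also have "\<dots> \<le> a h" using power[of "h / real n" n] n h by simp
    finally show ?thesis using h by (simp add: c_def algebra_simps)
  qed
  then show ?thesis unfolding a_def by (rule field_le_epsilon)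
qed

lemma P_atom_zero:
  assumes "\<And>z. \<bar>g z\<bar> \<le> B" "g x = 0" "0 \<le> h"
  shows "\<bar>P h g x\<bar> \<le> B * (q x * h)"
proof -
  have "0 \<le> B" using assms(1)[of x] by linarith
  have "\<bar>P h g x\<bar> \<le> B * (1 - pmf (K h x) x)"
    by (rule expectation_pmf_atom_zero) (use assms in auto)
  also have "\<dots> \<le> B * (q x * h)"
    using holding_prob[OF assms(3)] \<open>0 \<le> B\<close> by (intro mult_left_mono)
  finally show ?thesis .
qed

lemma P_bounded: "(\<And>z. \<bar>g z\<bar> \<le> B) \<Longrightarrow> \<bar>P t g x\<bar> \<le> B"
  by (rule expectation_pmf_bounded)

lemma P_add:
  assumes "\<And>z. \<bar>g z\<bar> \<le> B" "0 \<le> s" "0 \<le> t"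
  shows "P (s + t) g x = P s (P t g) x"
  using assms(2,3) by (simp add: K_add expectation_bind_pmf[OF assms(1)])

lemma P_diff_const:
  assumes "\<And>z. \<bar>g z\<bar> \<le> B"
  shows "P h (\<lambda>z. g z - c) x = P h g x - c"
  by (subst Bochner_Integration.integral_diff) (auto intro: integrable_pmf_bounded[OF assms])

lemma P_minus_self:
  assumes "\<And>z. \<bar>g z\<bar> \<le> B" "0 \<le> h"
  shows "\<bar>P h g x - g x\<bar> \<le> 2 * B * (q x * h)"
proof -
  have "\<bar>P h (\<lambda>z. g z - g x) x\<bar> \<le> 2 * B * (q x * h)"
  proof (rule P_atom_zero)
    show "\<bar>g z - g x\<bar> \<le> 2 * B" for z using assms(1)[of z] assms(1)[of x] by linarith
  qed (use assms in auto)
  then show ?thesis using assms by (simp add: P_diff_const[OF assms(1)])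
qed

text \<open>By the semigroup law a time shift is a short run of the chain applied to a function
  still bounded by \<open>B\<close>. The constant depends on the state through the exit rate, which
  therefore has to be integrable once such estimates are averaged.\<close>

lemma P_Lipschitz:
  assumes g: "\<And>z. \<bar>g z\<bar> \<le> B" and "0 \<le> s" "0 \<le> u"
  shows "\<bar>P u g x - P s g x\<bar> \<le> 2 * B * (q x * \<bar>u - s\<bar>)"
proof -
  have *: "\<bar>P u g x - P s g x\<bar> \<le> 2 * B * (q x * \<bar>u - s\<bar>)" if "0 \<le> s" "s \<le> u" for s u
  proof -
    have "P u g x = P (u - s) (P s g) x"
      using P_add[OF g, of "u - s" s] that by simp
    then show ?thesis
      using P_minus_self[of "P s g" B "u - s" x, OF P_bounded[OF g]] that by simp
  qed
  show ?thesis
    using *[of s u] *[of u s] assms by (cases "s \<le> u") (auto simp: abs_minus_commute)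
qed

section \<open>Integrability of the exit rate\<close>

text \<open>The diagonal of \<open>Q\<close> is arbitrary; with zeros there, sums may run over all
  states.\<close>

definition R :: "'a \<Rightarrow> 'a \<Rightarrow> real" where
  "R x y = (if y = x then 0 else Q x y)"

lemma R_nonneg: "0 \<le> R x y"
  by (simp add: R_def Q_nonneg)

lemma R_has_sum: "(R x has_sum q x) UNIV"
proof -
  have "(Q x has_sum q x) (- {x})"
    unfolding exit_rate_def using Q_summable by (rule has_sum_infsum)
  then show ?thesis
    by (rule has_sum_cong_neutral[THEN iffD1, rotated -1]) (auto simp: R_def)
qed

text \<open>For \<open>e = \<plusminus>1\<close> every term of \<open>- e y * generator Q e y = (\<Sum>z. (1 - e y * e z) * Q y z)\<close> is
  nonnegative, and for greedily chosen signs the cross terms \<open>e y * e z\<close> only help. Thus integrability of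
  \<open>generator Q e\<close> for a single bounded function controls the exit rate.\<close>

lemma integrable_exit_rate:
  assumes gen: "\<And>e :: 'a \<Rightarrow> real. (\<And>z. e z \<in> {-1, 1}) \<Longrightarrow> integrable (measure_pmf p) (generator Q e)"
  shows "integrable (measure_pmf p) q"
proof -
  obtain e :: "'a \<Rightarrow> real" where e: "\<And>y. e y \<in> {-1, 1}"
    and cross: "\<And>N. (\<Sum>y | to_nat y < N. \<Sum>z | to_nat z < N.
      if z = y then 0 else (pmf p y * Q y z) * (e y * e z)) \<le> 0"
    using greedy_signs[of "\<lambda>y z. pmf p y * Q y z"] by blast
  define F where "F N = {z::'a. to_nat z < N}" for N
  have fin: "finite (F N)" for N unfolding F_def by (rule finite_to_nat_less)
  have F_cover: "\<exists>N. H \<subseteq> F N" if "finite H" for H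
    using finite_nat_set_iff_bounded[of "to_nat ` H"] that by (auto simp: F_def)
  have e_prod: "e y * e z \<le> 1" for y z using e[of y] e[of z] by auto
  have int: "integrable (measure_pmf p) (\<lambda>y. \<bar>generator Q e y\<bar>)"
    by (intro integrable_abs gen e)
  have partial: "(\<Sum>z\<in>H. R y z * (1 - e y * e z)) \<le> \<bar>generator Q e y\<bar>" if "finite H" for H y
  proof -
    have "(\<lambda>z. (- e y) * ((e z - e y) * Q y z)) = (\<lambda>z. R y z * (1 - e y * e z))"
      using e[of y] by (auto simp: R_def algebra_simps)
    then have eq: "(\<Sum>\<^sub>\<infinity>z. R y z * (1 - e y * e z)) = (- e y) * generator Q e y"
      unfolding generator_def using infsum_cmult_right'[of "- e y" "\<lambda>z. (e z - e y) * Q y z" UNIV]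
      by simp
    have "(\<lambda>z. R y z * 2) summable_on UNIV"
      using R_has_sum by (intro summable_on_cmult_left) (auto simp: summable_on_def)
    then have "(\<lambda>z. R y z * (1 - e y * e z)) summable_on UNIV"
    proof (rule summable_on_comparison_test)
      show "R y z * (1 - e y * e z) \<le> R y z * 2" for z
        using e[of y] e[of z] R_nonneg by (intro mult_left_mono) auto
    qed (use e_prod R_nonneg in auto)
    then have "(\<Sum>z\<in>H. R y z * (1 - e y * e z)) \<le> (\<Sum>\<^sub>\<infinity>z. R y z * (1 - e y * e z))"
      using that e_prod R_nonneg by (intro finite_sum_le_infsum) auto
    also have "\<dots> \<le> \<bar>generator Q e y\<bar>" using e[of y] unfolding eq by auto
    finally show ?thesis .
  qed
  define C where "C = measure_pmf.expectation p (\<lambda>y. \<bar>generator Q e y\<bar>)"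
  have double: "(\<Sum>y\<in>G. pmf p y * (\<Sum>z\<in>H. R y z)) \<le> C" if GH: "finite G" "finite H" for G H
  proof -
    \<comment> \<open>The signs control the cross terms only on initial segments of the enumeration,
      so both index sets are enlarged to a common one.\<close>
    from F_cover[of "G \<union> H"] GH obtain N where N: "G \<subseteq> F N" "H \<subseteq> F N" by auto
    have "(\<Sum>y\<in>G. pmf p y * (\<Sum>z\<in>H. R y z)) \<le> (\<Sum>y\<in>F N. pmf p y * (\<Sum>z\<in>F N. R y z))"
      using fin N by (intro order_trans[OF sum_mono[OF mult_left_mono[OF sum_mono2]] sum_mono2])
        (auto intro!: mult_nonneg_nonneg sum_nonneg R_nonneg)
    also have "\<dots> \<le> (\<Sum>y\<in>F N. pmf p y * (\<Sum>z\<in>F N. R y z)) -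
        (\<Sum>y\<in>F N. \<Sum>z\<in>F N. if z = y then 0 else (pmf p y * Q y z) * (e y * e z))"
      using cross[of N] by (simp add: F_def)
    also have "\<dots> = (\<Sum>y\<in>F N. pmf p y * (\<Sum>z\<in>F N. R y z * (1 - e y * e z)))"
      unfolding sum_subtractf[symmetric] sum_distrib_left
      by (intro sum.cong refl) (auto simp: R_def algebra_simps)
    also have "\<dots> \<le> (\<Sum>y\<in>F N. (\<bar>generator Q e y\<bar> * indicator (F N) y) * pmf p y)"
      using partial[OF fin] by (intro sum_mono) (auto simp: mult.commute intro!: mult_left_mono)
    also have "\<dots> = measure_pmf.expectation p (\<lambda>y. \<bar>generator Q e y\<bar> * indicator (F N) y)"
      by (rule integral_measure_pmf_real[symmetric, OF fin]) (auto simp: indicator_def split: if_splits)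
    also have "\<dots> \<le> C" unfolding C_def
      by (rule integral_mono[OF integrable_real_mult_indicator[OF _ int] int]) (auto simp: indicator_def)
    finally show ?thesis .
  qed
  \<comment> \<open>The sums over \<open>z\<close> are exhausted first, with \<open>G\<close> fixed
    and finite, so that only finitely many limits are added; the bound \<open>C\<close> does not
    depend on \<open>G\<close>.\<close>
  have single: "(\<Sum>y\<in>G. pmf p y * q y) \<le> C" if "finite G" for G
  proof (rule tendsto_le[OF finite_subsets_at_top_neq_bot tendsto_const])
    show "((\<lambda>H. \<Sum>y\<in>G. pmf p y * (\<Sum>z\<in>H. R y z)) \<longlongrightarrow> (\<Sum>y\<in>G. pmf p y * q y))
        (finite_subsets_at_top UNIV)"
      using R_has_sum unfolding has_sum_def by (intro tendsto_intros)
    show "\<forall>\<^sub>F H in finite_subsets_at_top UNIV. (\<Sum>y\<in>G. pmf p y * (\<Sum>z\<in>H. R y z)) \<le> C"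
      using double[OF that] by (auto intro: eventually_finite_subsets_at_top_weakI)
  qed
  have "(\<lambda>y. pmf p y * q y) summable_on UNIV"
  proof (rule nonneg_bdd_above_summable_on)
    show "bdd_above (sum (\<lambda>y. pmf p y * q y) ` {G. G \<subseteq> UNIV \<and> finite G})"
      using single by (intro bdd_aboveI[of _ C]) blast
  qed (simp add: q_nonneg)
  then have "integrable (count_space UNIV) (\<lambda>y. pmf p y * q y)"
    unfolding abs_summable_on_def[symmetric] abs_summable_equivalent[symmetric]
    by (rule summable_on_iff_abs_summable_on_real[THEN iffD1])
  then show ?thesis
    unfolding measure_pmf_eq_density by (subst integrable_density) auto
qed

section \<open>Short-time limits of expectations\<close>

text \<open>Each \<open>pmf (K h y) z / h\<close> tends to a rate, but exchanging this limit with
  the sum over \<open>z\<close> needs tightness. Conservativity provides it: the mass off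
  \<open>insert y F\<close>, divided by \<open>h\<close>, tends to \<open>q y - sum (Q y) F\<close>,
  which is small for a large finite \<open>F\<close>. The integrands vary with \<open>n\<close>
  because they will come from the semigroup at shifted times.\<close>

lemma rate_limit:
  assumes h: "\<And>n. 0 < h n" "h \<longlonglongrightarrow> 0"
    and b: "\<And>n z. \<bar>b n z\<bar> \<le> B" "\<And>n. b n y = 0"
    and lim: "\<And>z. (\<lambda>n. b n z) \<longlonglongrightarrow> c z"
  shows "(\<lambda>n. P (h n) (b n) y / h n) \<longlonglongrightarrow> (\<Sum>\<^sub>\<infinity>z. c z * R y z)"
proof -
  have B: "0 \<le> B" using b(1)[of 0 y] by linarith
  have c: "\<bar>c z\<bar> \<le> B" for z
    by (rule tendsto_upperbound[OF tendsto_rabs[OF lim[of z]]]) (use b in auto)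
  have h_filter: "filterlim h (at_right 0) sequentially"
    unfolding filterlim_at using h by (auto intro!: always_eventually simp: less_imp_neq[symmetric])
  have off: "(\<lambda>n. pmf (K (h n) y) z / h n) \<longlonglongrightarrow> Q y z" if "z \<noteq> y" for z
    using rates that unfolding has_rates_def
    by (intro filterlim_compose[OF _ h_filter, of "\<lambda>h. pmf (K h y) z / h"]) auto
  have diag: "(\<lambda>n. (1 - pmf (K (h n) y) y) / h n) \<longlonglongrightarrow> q y"
    using rates unfolding has_rates_def
    by (intro filterlim_compose[OF _ h_filter, of "\<lambda>h. (1 - pmf (K h y) y) / h"]) auto
  have R_sum: "R y summable_on A" for A
    using R_has_sum[of y] summable_on_subset[of "R y" UNIV A] by (auto simp: summable_on_def)
  have cR_sum: "(\<lambda>z. c z * R y z) summable_on A" for A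
  proof (rule abs_summable_summable, rule summable_on_comparison_test)
    show "(\<lambda>z. B * R y z) summable_on A" by (intro summable_on_cmult_right R_sum)
    show "norm (c z * R y z) \<le> B * R y z" for z
      using c[of z] R_nonneg[of y z] by (simp add: abs_mult mult_right_mono)
  qed auto
  show ?thesis
  proof (rule tendstoI)
    fix \<epsilon> :: real assume "0 < \<epsilon>"
    \<comment> \<open>Three errors must fit into \<epsilon>: the tails of the series and of the
      expectation cost \<open>B * \<delta>\<close> each, the finite part costs \<delta>.\<close>
    define \<delta> where "\<delta> = \<epsilon> / (2 * B + 2)"
    have "0 < \<delta>" using \<open>0 < \<epsilon>\<close> B by (simp add: \<delta>_def)
    moreover have "\<delta> * (2 * B + 2) = \<epsilon>" using B by (simp add: \<delta>_def)
    ultimately have \<delta>: "0 < \<delta>" "2 * (B * \<delta>) + \<delta> < \<epsilon>"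
      by (simp_all add: algebra_simps)
    have "\<forall>\<^sub>F F in finite_subsets_at_top (- {y}). q y - \<delta> < sum (Q y) F"
    proof (rule order_tendstoD)
      show "(sum (Q y) \<longlongrightarrow> q y) (finite_subsets_at_top (- {y}))"
        using has_sum_infsum[OF Q_summable] by (simp add: has_sum_def exit_rate_def)
    qed (use \<delta> in simp)
    then obtain F where F: "finite F" "F \<subseteq> - {y}" "q y - \<delta> < sum (Q y) F"
      by (auto simp: eventually_finite_subsets_at_top)
    have RF: "sum (R y) F = sum (Q y) F"
      using F by (intro sum.cong) (auto simp: R_def)
    define T where "T = (\<Sum>z\<in>F. c z * Q y z)"
    have tail_Q: "\<bar>(\<Sum>\<^sub>\<infinity>z. c z * R y z) - T\<bar> \<le> B * \<delta>"
    proof -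
      have "(\<Sum>\<^sub>\<infinity>z. c z * R y z) = (\<Sum>z\<in>F. c z * R y z) + (\<Sum>\<^sub>\<infinity>z\<in>-F. c z * R y z)"
        using infsum_Un_disjoint[OF cR_sum[of F] cR_sum[of "-F"]] F(1) by simp
      moreover have "(\<Sum>z\<in>F. c z * R y z) = T"
        unfolding T_def using F by (intro sum.cong) (auto simp: R_def)
      moreover have "norm (\<Sum>\<^sub>\<infinity>z\<in>-F. c z * R y z) \<le> (\<Sum>\<^sub>\<infinity>z\<in>-F. B * R y z)"
      proof (rule norm_infsum_le)
        show "((\<lambda>z. c z * R y z) has_sum (\<Sum>\<^sub>\<infinity>z\<in>-F. c z * R y z)) (-F)"
          using cR_sum by (rule has_sum_infsum)
        show "((\<lambda>z. B * R y z) has_sum (\<Sum>\<^sub>\<infinity>z\<in>-F. B * R y z)) (-F)"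
          by (intro has_sum_infsum summable_on_cmult_right R_sum)
        show "norm (c z * R y z) \<le> B * R y z" for z
          using c[of z] R_nonneg[of y z] by (simp add: abs_mult mult_right_mono)
      qed
      moreover have "(\<Sum>\<^sub>\<infinity>z\<in>-F. B * R y z) = B * (\<Sum>\<^sub>\<infinity>z\<in>-F. R y z)"
        by (rule infsum_cmult_right')
      moreover have "q y = sum (R y) F + (\<Sum>\<^sub>\<infinity>z\<in>-F. R y z)"
        using infsum_Un_disjoint[OF R_sum[of F] R_sum[of "-F"]] F(1) infsumI[OF R_has_sum[of y]] by simp
      moreover have "B * (\<Sum>\<^sub>\<infinity>z\<in>-F. R y z) \<le> B * \<delta>" if "q y = sum (R y) F + (\<Sum>\<^sub>\<infinity>z\<in>-F. R y z)"
        using that F(3) RF B by (intro mult_left_mono) auto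
      ultimately show ?thesis
        by simp
    qed
    \<comment> \<open>As \<open>b n\<close> vanishes at \<open>y\<close>, the state \<open>y\<close>
      can be removed along with \<open>F\<close>. It carries almost all the mass, and only what is
      left is small compared with \<open>h n\<close>.\<close>
    have tail_P: "\<bar>P (h n) (b n) y - (\<Sum>z\<in>F. b n z * pmf (K (h n) y) z)\<bar>
        \<le> B * (1 - pmf (K (h n) y) y - (\<Sum>z\<in>F. pmf (K (h n) y) z))" for n
    proof -
      let ?p = "K (h n) y"
      have int: "integrable (measure_pmf ?p) (\<lambda>z. b n z * indicator S z)" for S
        by (rule integrable_pmf_bounded[of _ B]) (use b(1)[of n] B in \<open>auto simp: indicator_def\<close>)
      have "P (h n) (b n) y = measure_pmf.expectation ?p (\<lambda>z. b n z * indicator F z + b n z * indicator (-F) z)"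
        by (intro Bochner_Integration.integral_cong) (auto simp: indicator_def)
      also have "\<dots> = measure_pmf.expectation ?p (\<lambda>z. b n z * indicator F z)
          + measure_pmf.expectation ?p (\<lambda>z. b n z * indicator (-F) z)"
        by (rule Bochner_Integration.integral_add[OF int int])
      also have "measure_pmf.expectation ?p (\<lambda>z. b n z * indicator F z) = (\<Sum>z\<in>F. b n z * pmf ?p z)"
        by (subst integral_measure_pmf_real[OF F(1)]) (auto simp: indicator_def split: if_splits)
      finally have "\<bar>P (h n) (b n) y - (\<Sum>z\<in>F. b n z * pmf ?p z)\<bar>
          = \<bar>measure_pmf.expectation ?p (\<lambda>z. b n z * indicator (-F) z)\<bar>" by simp
      also have "\<dots> \<le> measure_pmf.expectation ?p (\<lambda>z. B * indicator (- insert y F) z)"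
        using b(1)[of n] b(2)[of n] B
        by (intro order_trans[OF integral_abs_bound] integral_mono integrable_abs int
            integrable_pmf_bounded[of _ B]) (auto simp: indicator_def)
      also have "\<dots> = B * measure_pmf.prob ?p (- insert y F)" by simp
      also have "measure_pmf.prob ?p (- insert y F) = 1 - measure_pmf.prob ?p (insert y F)"
        using measure_pmf.prob_compl[of "insert y F" ?p] by (simp add: Compl_eq_Diff_UNIV)
      also have "measure_pmf.prob ?p (insert y F) = pmf ?p y + (\<Sum>z\<in>F. pmf ?p z)"
        using F by (subst measure_measure_pmf_finite) auto
      finally show ?thesis by (simp add: algebra_simps)
    qed
    have "(\<lambda>n. (1 - pmf (K (h n) y) y) / h n - (\<Sum>z\<in>F. pmf (K (h n) y) z / h n))
        \<longlonglongrightarrow> q y - sum (Q y) F"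
      using F by (intro tendsto_intros diag off) auto
    then have ev1: "\<forall>\<^sub>F n in sequentially.
        (1 - pmf (K (h n) y) y) / h n - (\<Sum>z\<in>F. pmf (K (h n) y) z / h n) < \<delta>"
      by (rule order_tendstoD) (use F in simp)
    have "(\<lambda>n. \<Sum>z\<in>F. b n z * (pmf (K (h n) y) z / h n)) \<longlonglongrightarrow> T"
      unfolding T_def using F by (intro tendsto_intros lim off) auto
    then have ev2: "\<forall>\<^sub>F n in sequentially.
        dist (\<Sum>z\<in>F. b n z * (pmf (K (h n) y) z / h n)) T < \<delta>"
      using \<delta>(1) by (rule tendstoD)
    from ev1 ev2 show "\<forall>\<^sub>F n in sequentially.
        dist (P (h n) (b n) y / h n) (\<Sum>\<^sub>\<infinity>z. c z * R y z) < \<epsilon>"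
    proof eventually_elim
      case (elim n)
      have "\<bar>P (h n) (b n) y / h n - (\<Sum>z\<in>F. b n z * (pmf (K (h n) y) z / h n))\<bar>
          = \<bar>P (h n) (b n) y - (\<Sum>z\<in>F. b n z * pmf (K (h n) y) z)\<bar> / h n"
        using h(1)[of n] by (simp add: sum_divide_distrib[symmetric] diff_divide_distrib[symmetric])
      also have "\<dots> \<le> B * (1 - pmf (K (h n) y) y - (\<Sum>z\<in>F. pmf (K (h n) y) z)) / h n"
        using h(1)[of n] by (intro divide_right_mono tail_P) simp
      also have "\<dots> = B * ((1 - pmf (K (h n) y) y) / h n - (\<Sum>z\<in>F. pmf (K (h n) y) z / h n))"
        by (simp add: sum_divide_distrib[symmetric] diff_divide_distrib[symmetric])
      also have "\<dots> \<le> B * \<delta>" using elim B by (intro mult_left_mono) auto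
      finally show ?case
        using elim(2) tail_Q \<delta>(2) unfolding dist_real_def by linarith
    qed
  qed
qed

section \<open>Covariances over short times\<close>

definition covar :: "real \<Rightarrow> ('a \<Rightarrow> real) \<Rightarrow> ('a \<Rightarrow> real) \<Rightarrow> 'a \<Rightarrow> real" where
  "covar h v w y = P h (\<lambda>z. v z * w z) y - P h v y * P h w y"

context
  fixes v w :: "'a \<Rightarrow> real" and B C :: real
  assumes v: "\<And>z. \<bar>v z\<bar> \<le> B" and w: "\<And>z. \<bar>w z\<bar> \<le> C"
begin

lemma bounds_nonneg: "0 \<le> B" "0 \<le> C"
  using order_trans[OF abs_ge_zero v] order_trans[OF abs_ge_zero w] by auto

lemma prod_bounded: "\<bar>v z * w z\<bar> \<le> B * C"
  unfolding abs_mult using v w bounds_nonneg by (intro mult_mono) auto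

lemma centered_prod_bounded: "\<bar>(v z - a) * (w z - b)\<bar> \<le> (B + \<bar>a\<bar>) * (C + \<bar>b\<bar>)"
  unfolding abs_mult using v[of z] w[of z] bounds_nonneg by (intro mult_mono) auto

text \<open>Covariance ignores constant shifts. With \<open>a = v y\<close> and
  \<open>b = w y\<close> the integrand vanishes at the starting state, so both parts become small
  with \<open>h\<close>.\<close>

lemma covar_eq:
  "covar h v w y = P h (\<lambda>z. (v z - a) * (w z - b)) y - (P h v y - a) * (P h w y - b)"
proof -
  note [simp] = integrable_pmf_bounded[of v, OF v] integrable_pmf_bounded[of w, OF w]
    integrable_pmf_bounded[of "\<lambda>z. v z * w z", OF prod_bounded]
  have "P h (\<lambda>z. (v z - a) * (w z - b)) y = P h (\<lambda>z. v z * w z - b * v z - a * w z + a * b) y"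
    by (simp add: algebra_simps)
  also have "\<dots> = P h (\<lambda>z. v z * w z) y - b * P h v y - a * P h w y + a * b"
    by simp
  finally show ?thesis by (simp add: covar_def algebra_simps)
qed

lemma covar_bounded:
  assumes "0 \<le> h"
  shows "\<bar>covar h v w y\<bar> \<le> 8 * (B * C) * (q y * h)"
proof -
  have 1: "\<bar>P h (\<lambda>z. (v z - v y) * (w z - w y)) y\<bar> \<le> (2 * B) * (2 * C) * (q y * h)"
  proof (rule P_atom_zero)
    show "\<bar>(v z - v y) * (w z - w y)\<bar> \<le> (2 * B) * (2 * C)" for z
      using v[of y] w[of y] bounds_nonneg
      by (intro order_trans[OF centered_prod_bounded] mult_mono) auto
  qed (use assms in auto)
  \<comment> \<open>Only one factor is estimated through the exit rate, the other by its crude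
    bound: the result stays linear in \<open>q y\<close>, whose square need not be integrable. The
    two parts contribute 4 each to the constant 8.\<close>
  have "\<bar>P h v y - v y\<bar> * \<bar>P h w y - w y\<bar> \<le> (2 * B * (q y * h)) * (2 * C)"
  proof (rule mult_mono)
    show "\<bar>P h w y - w y\<bar> \<le> 2 * C"
      using P_bounded[of w C h y, OF w] w[of y] by linarith
    show "0 \<le> 2 * B * (q y * h)" using bounds_nonneg q_nonneg assms by simp
  qed (use P_minus_self[of v B h y, OF v] assms in auto)
  then have "\<bar>(P h v y - v y) * (P h w y - w y)\<bar> \<le> (2 * B * (q y * h)) * (2 * C)"
    by (simp add: abs_mult)
  with 1 show ?thesis
    unfolding covar_eq[where a = "v y" and b = "w y"] by (simp add: algebra_simps abs_le_iff)
qed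

end

text \<open>After centering at \<open>y\<close>, the product of the two mean increments is of order
  \<open>h n\<close> squared at fixed \<open>y\<close> and drops out. The centered product falls
  under \<open>rate_limit\<close> and gives twice the carre du champ.\<close>

lemma covar_limit:
  assumes h: "\<And>n. 0 < h n" "h \<longlonglongrightarrow> 0"
    and v: "\<And>n z. \<bar>v n z\<bar> \<le> B" "\<And>z. (\<lambda>n. v n z) \<longlonglongrightarrow> v' z"
    and w: "\<And>n z. \<bar>w n z\<bar> \<le> C" "\<And>z. (\<lambda>n. w n z) \<longlonglongrightarrow> w' z"
  shows "(\<lambda>n. covar (h n) (v n) (w n) y / h n) \<longlonglongrightarrow> (\<Sum>\<^sub>\<infinity>z. (v' z - v' y) * (w' z - w' y) * Q y z)"
proof -
  have BC: "0 \<le> B" "0 \<le> C" using bounds_nonneg[OF v(1) w(1)] by auto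
  have 1: "(\<lambda>n. P (h n) (\<lambda>z. (v n z - v n y) * (w n z - w n y)) y / h n)
      \<longlonglongrightarrow> (\<Sum>\<^sub>\<infinity>z. (v' z - v' y) * (w' z - w' y) * R y z)"
  proof (rule rate_limit[OF h])
    show "\<bar>(v n z - v n y) * (w n z - w n y)\<bar> \<le> (2 * B) * (2 * C)" for n z
      using v(1)[of n y] w(1)[of n y] BC
      by (intro order_trans[OF centered_prod_bounded[OF v(1) w(1)]] mult_mono) auto
    show "(\<lambda>n. (v n z - v n y) * (w n z - w n y)) \<longlonglongrightarrow> (v' z - v' y) * (w' z - w' y)" for z
      by (intro tendsto_intros v w)
  qed simp
  have 2: "(\<lambda>n. (P (h n) (v n) y - v n y) * (P (h n) (w n) y - w n y) / h n) \<longlonglongrightarrow> 0"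
  proof (rule Lim_null_comparison)
    show "\<forall>\<^sub>F n in sequentially. norm ((P (h n) (v n) y - v n y) * (P (h n) (w n) y - w n y) / h n)
        \<le> (2 * B * q y) * (2 * C * q y) * h n"
    proof (intro always_eventually allI)
      fix n
      have hn: "0 \<le> h n" using h(1)[of n] by simp
      have "\<bar>P (h n) (v n) y - v n y\<bar> * \<bar>P (h n) (w n) y - w n y\<bar>
          \<le> (2 * B * (q y * h n)) * (2 * C * (q y * h n))"
        using BC q_nonneg[of y] hn by (intro mult_mono P_minus_self v w) auto
      then show "norm ((P (h n) (v n) y - v n y) * (P (h n) (w n) y - w n y) / h n)
          \<le> (2 * B * q y) * (2 * C * q y) * h n"
        using h(1)[of n] unfolding real_norm_def abs_divide abs_mult
        by (simp add: pos_divide_le_eq mult_ac)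
    qed
    show "(\<lambda>n. (2 * B * q y) * (2 * C * q y) * h n) \<longlonglongrightarrow> 0"
      by (intro tendsto_mult_right_zero h)
  qed
  have "(\<lambda>z. (v' z - v' y) * (w' z - w' y) * R y z) = (\<lambda>z. (v' z - v' y) * (w' z - w' y) * Q y z)"
    by (auto simp: R_def)
  moreover have "covar (h n) (v n) (w n) y = P (h n) (\<lambda>z. (v n z - v n y) * (w n z - w n y)) y
      - (P (h n) (v n) y - v n y) * (P (h n) (w n) y - w n y)" for n
    by (rule covar_eq[OF v(1) w(1)])
  ultimately show ?thesis
    using tendsto_diff[OF 1 2] by (simp add: diff_divide_distrib)
qed

text \<open>A step of the interpolation \<phi> is exactly a short-time covariance averaged by
  \<open>P s\<close>. Its right derivative is thus the left side of \<open>carre\<close>, to be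
  compared with the derivative of \<open>J\<close>.\<close>

lemma covar_le:
  assumes g: "\<And>z. \<bar>g z\<bar> \<le> B" and k: "\<And>z. \<bar>k z\<bar> \<le> C" and "0 < t"
    and int_q: "\<And>s. 0 \<le> s \<Longrightarrow> integrable (measure_pmf (K s x)) q"
    and carre: "\<And>s. \<lbrakk>0 \<le> s; s < t\<rbrakk> \<Longrightarrow>
      P s (\<lambda>y. \<Sum>\<^sub>\<infinity>z. (P (t - s) g z - P (t - s) g y) * (P (t - s) k z - P (t - s) k y) * Q y z) x
        \<le> c * exp (- 2 * \<rho> * (t - s))"
  shows "covar t g k x \<le> c * L_const t \<rho>"
proof -
  have BC: "0 \<le> B" "0 \<le> C" using bounds_nonneg[OF g k] by auto
  define m where "m s y = P (t - s) g y * P (t - s) k y" for s y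
  define \<phi> where "\<phi> s = P s (m s) x" for s
  \<comment> \<open>An antiderivative of the bound in \<open>carre\<close>, chosen so that its
    increment over [0, t] is \<open>c * L_const t \<rho>\<close>, for \<open>\<rho> = 0\<close>
    too.\<close>
  define J where "J s = c * (if \<rho> = 0 then s else exp (- 2 * \<rho> * (t - s)) / (2 * \<rho>))" for s
  have J_deriv: "(J has_real_derivative c * exp (- 2 * \<rho> * (t - s))) (at s)" for s
    unfolding J_def by (cases "\<rho> = 0") (auto intro!: derivative_eq_intros)
  have m_bounded: "\<bar>m s y\<bar> \<le> B * C" for s y
    unfolding m_def by (rule prod_bounded) (intro P_bounded g k)+
  have m_Lipschitz: "\<bar>m u y - m s y\<bar> \<le> 4 * (B * C) * \<bar>u - s\<bar> * q y" if "s \<in> {0..t}" "u \<in> {0..t}" for s u y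
  proof -
    have "m u y - m s y = (P (t - u) g y - P (t - s) g y) * P (t - u) k y
        + P (t - s) g y * (P (t - u) k y - P (t - s) k y)"
      by (simp add: m_def algebra_simps)
    also have "\<bar>\<dots>\<bar> \<le> \<bar>P (t - u) g y - P (t - s) g y\<bar> * \<bar>P (t - u) k y\<bar>
        + \<bar>P (t - s) g y\<bar> * \<bar>P (t - u) k y - P (t - s) k y\<bar>"
      unfolding abs_mult[symmetric] by (rule abs_triangle_ineq)
    also have "\<dots> \<le> (2 * B * (q y * \<bar>(t - u) - (t - s)\<bar>)) * C + B * (2 * C * (q y * \<bar>(t - u) - (t - s)\<bar>))"
      using that BC q_nonneg[of y]
      by (intro add_mono mult_mono P_Lipschitz P_bounded g k) auto
    also have "\<bar>(t - u) - (t - s)\<bar> = \<bar>u - s\<bar>" by simp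
    finally show ?thesis by (simp add: algebra_simps)
  qed
  have m_int: "integrable (measure_pmf p) (m s)" for p s
    by (rule integrable_pmf_bounded[OF m_bounded])
  \<comment> \<open>Both the averaging time and the integrand move. The motion of the integrand is
    averaged over the state at time \<open>s\<close>, whence \<open>P s q x\<close>. The constant
    depends on \<open>s\<close>, which is enough for continuity.\<close>
  have \<phi>_Lipschitz: "\<bar>\<phi> u - \<phi> s\<bar> \<le> (2 * (B * C) * q x + 4 * (B * C) * P s q x) * \<bar>u - s\<bar>"
    if "s \<in> {0..t}" "u \<in> {0..t}" for s u
  proof -
    have 1: "\<bar>P u (m u) x - P s (m u) x\<bar> \<le> 2 * (B * C) * (q x * \<bar>u - s\<bar>)"
      using that by (intro P_Lipschitz m_bounded) auto
    have "P s (m u) x - P s (m s) x = P s (\<lambda>y. m u y - m s y) x"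
      by (rule Bochner_Integration.integral_diff[symmetric]) (rule m_int)+
    also have "\<bar>\<dots>\<bar> \<le> P s (\<lambda>y. 4 * (B * C) * \<bar>u - s\<bar> * q y) x"
      using that by (intro order_trans[OF integral_abs_bound] integral_mono integrable_abs
          Bochner_Integration.integrable_diff m_int integrable_mult_right int_q m_Lipschitz) auto
    finally have 2: "\<bar>P s (m u) x - P s (m s) x\<bar> \<le> 4 * (B * C) * \<bar>u - s\<bar> * P s q x"
      by simp
    from 1 2 show ?thesis unfolding \<phi>_def by (simp add: algebra_simps abs_le_iff)
  qed
  have "continuous_on {0..t} \<phi>"
    unfolding continuous_on
  proof
    fix s assume s: "s \<in> {0..t}"
    show "(\<phi> \<longlongrightarrow> \<phi> s) (at s within {0..t})"
    proof (rule LIM_zero_cancel, rule Lim_null_comparison)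
      show "\<forall>\<^sub>F u in at s within {0..t}.
          norm (\<phi> u - \<phi> s) \<le> (2 * (B * C) * q x + 4 * (B * C) * P s q x) * \<bar>u - s\<bar>"
        using \<phi>_Lipschitz[OF s] by (auto simp: eventually_at_filter)
      show "((\<lambda>u. (2 * (B * C) * q x + 4 * (B * C) * P s q x) * \<bar>u - s\<bar>) \<longlongrightarrow> 0) (at s within {0..t})"
        by (rule tendsto_eq_intros | simp)+
    qed
  qed
  moreover have "continuous_on {0..t} J"
    by (rule DERIV_continuous_on) (rule has_field_derivative_at_within[OF J_deriv])
  ultimately have cont: "continuous_on {0..t} (\<lambda>s. \<phi> s - J s)"
    by (rule continuous_on_diff)
  have "\<phi> t - J t \<le> \<phi> 0 - J 0"
  proof (rule dini_le[OF _ cont])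
    fix s \<epsilon> :: real assume s: "0 \<le> s" "s < t" and "0 < \<epsilon>"
    define h where "h n = (t - s) / real (Suc n)" for n
    have h: "0 < h n" "h n \<le> t - s" for n
      using s mult_left_mono[of 1 "real (Suc n)" "t - s"] by (auto simp: h_def pos_divide_le_eq)
    have h0: "h \<longlonglongrightarrow> 0" unfolding h_def by real_asymp
    define v where "v n = P (t - s - h n) g" for n
    define w where "w n = P (t - s - h n) k" for n
    have conv: "(\<lambda>n. P (t - s - h n) f z) \<longlonglongrightarrow> P (t - s) f z" if "\<And>z. \<bar>f z\<bar> \<le> D" for f D z
    proof (rule LIM_zero_cancel, rule Lim_null_comparison)
      show "\<forall>\<^sub>F n in sequentially. norm (P (t - s - h n) f z - P (t - s) f z) \<le> 2 * D * (q z * h n)"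
        using P_Lipschitz[OF that, of "t - s" "t - s - h _"] h s by (auto simp: abs_of_pos)
      show "(\<lambda>n. 2 * D * (q z * h n)) \<longlonglongrightarrow> 0" by (intro tendsto_mult_right_zero h0)
    qed
    have v_b: "\<bar>v n z\<bar> \<le> B" and w_b: "\<bar>w n z\<bar> \<le> C" for n z
      unfolding v_def w_def by (intro P_bounded g k)+
    \<comment> \<open>Splitting \<open>P (t - s)\<close> into \<open>P (h n)\<close> and
      \<open>P (t - s - h n)\<close> expresses both values of \<phi> by the same pair
      \<open>v n\<close>, \<open>w n\<close>: a mean of products against a product of means.\<close>
    have step: "\<phi> (s + h n) - \<phi> s = P s (covar (h n) (v n) (w n)) x" for n
    proof -
      have [simp]: "m (s + h n) = (\<lambda>z. v n z * w n z)"
        by (simp add: m_def v_def w_def fun_eq_iff diff_diff_eq)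
      have eq: "P (t - s) f y = P (h n) (P (t - s - h n) f) y" if "\<And>z. \<bar>f z\<bar> \<le> D" for f D y
        using P_add[OF that, of "h n" "t - s - h n"] h[of n] by simp
      have "\<phi> (s + h n) = P s (P (h n) (m (s + h n))) x"
        unfolding \<phi>_def using h[of n] s by (intro P_add[OF m_bounded]) auto
      moreover have "m s = (\<lambda>y. P (h n) (v n) y * P (h n) (w n) y)"
        by (simp add: m_def v_def w_def fun_eq_iff eq[OF g] eq[OF k])
      moreover have "integrable (measure_pmf p) (P (h n) (m (s + h n)))" for p
        by (rule integrable_pmf_bounded[OF P_bounded[OF m_bounded]])
      ultimately show ?thesis
        using m_int[of _ s] unfolding \<phi>_def covar_def
        by (subst Bochner_Integration.integral_diff) auto
    qed
    have "(\<lambda>n. P s (\<lambda>y. covar (h n) (v n) (w n) y / h n) x)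
        \<longlonglongrightarrow> P s (\<lambda>y. \<Sum>\<^sub>\<infinity>z. (P (t - s) g z - P (t - s) g y) * (P (t - s) k z - P (t - s) k y) * Q y z) x"
    proof (rule integral_dominated_convergence)
      show "integrable (measure_pmf (K s x)) (\<lambda>y. 8 * (B * C) * q y)"
        using s by (intro integrable_mult_right int_q)
      show "AE y in measure_pmf (K s x). norm (covar (h n) (v n) (w n) y / h n) \<le> 8 * (B * C) * q y" for n
        using covar_bounded[OF v_b w_b, of "h n"] h(1)[of n] by (auto simp: field_simps)
      show "AE y in measure_pmf (K s x). (\<lambda>n. covar (h n) (v n) (w n) y / h n)
          \<longlonglongrightarrow> (\<Sum>\<^sub>\<infinity>z. (P (t - s) g z - P (t - s) g y) * (P (t - s) k z - P (t - s) k y) * Q y z)"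
        by (intro AE_I2 covar_limit[where B = B and C = C] h h0 v_b w_b)
           (auto simp: v_def w_def intro!: conv[OF g] conv[OF k])
    qed auto
    then have "(\<lambda>n. (\<phi> (s + h n) - \<phi> s) / h n)
        \<longlonglongrightarrow> P s (\<lambda>y. \<Sum>\<^sub>\<infinity>z. (P (t - s) g z - P (t - s) g y) * (P (t - s) k z - P (t - s) k y) * Q y z) x"
      by (simp add: step)
    moreover have "(\<lambda>n. (J (s + h n) - J s) / h n) \<longlonglongrightarrow> c * exp (- 2 * \<rho> * (t - s))"
      using J_deriv[of s] unfolding DERIV_def
      by (rule filterlim_compose)
         (use h h0 in \<open>auto simp: filterlim_at less_imp_neq[symmetric] intro!: always_eventually\<close>)
    ultimately have "(\<lambda>n. (\<phi> (s + h n) - \<phi> s) / h n - (J (s + h n) - J s) / h n)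
        \<longlonglongrightarrow> P s (\<lambda>y. \<Sum>\<^sub>\<infinity>z. (P (t - s) g z - P (t - s) g y) * (P (t - s) k z - P (t - s) k y) * Q y z) x
          - c * exp (- 2 * \<rho> * (t - s))"
      by (rule tendsto_diff)
    then have "\<forall>\<^sub>F n in sequentially. (\<phi> (s + h n) - \<phi> s) / h n - (J (s + h n) - J s) / h n < \<epsilon>"
      by (rule order_tendstoD) (use carre[OF s] \<open>0 < \<epsilon>\<close> in linarith)
    then obtain n where "(\<phi> (s + h n) - \<phi> s) / h n - (J (s + h n) - J s) / h n < \<epsilon>"
      by (auto dest!: eventually_happens)
    then have "\<phi> (s + h n) - J (s + h n) \<le> \<phi> s - J s + \<epsilon> * (s + h n - s)"
      using h(1)[of n] by (simp add: diff_divide_distrib[symmetric] pos_divide_less_eq)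
    then show "\<exists>u>s. u \<le> t \<and> \<phi> u - J u \<le> \<phi> s - J s + \<epsilon> * (u - s)"
      using h[of n] by (intro exI[of _ "s + h n"]) auto
  qed (use \<open>0 < t\<close> in simp)
  moreover have "m t = (\<lambda>z. g z * k z)"
    by (simp add: m_def fun_eq_iff K_0)
  then have "\<phi> t = P t (\<lambda>z. g z * k z) x" "\<phi> 0 = P t g x * P t k x"
    by (simp_all add: \<phi>_def m_def K_0)
  moreover have "J t - J 0 = c * L_const t \<rho>"
    by (simp add: J_def L_const_def algebra_simps diff_divide_distrib)
  ultimately show ?thesis by (simp add: covar_def)
qed

end

section \<open>Chains with curvature bounded below\<close>

context regular_markov_chain
begin

text \<open>A \<open>pmf\<close> because the state space is countable. It has its meaning for
  \<open>0 \<le> t\<close> only, where \<open>X t\<close> is assumed to be measurable.\<close>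

definition kernel :: "real \<Rightarrow> 'a \<Rightarrow> 'a pmf" where
  "kernel t x = Abs_pmf (distr (Pr x) (count_space UNIV) (X t))"

lemma measure_kernel:
  assumes "0 \<le> t"
  shows "measure_pmf (kernel t x) = distr (Pr x) (count_space UNIV) (X t)"
proof -
  interpret D: prob_space "distr (Pr x) (count_space UNIV) (X t)"
    by (rule prob_space.prob_space_distr[OF prob_space measurable[OF assms]])
  have "AE z in distr (Pr x) (count_space UNIV) (X t).
      Sigma_Algebra.measure (distr (Pr x) (count_space UNIV) (X t)) {z} \<noteq> 0"
    by (subst D.AE_support_countable) (auto intro!: exI[of _ UNIV])
  then show ?thesis
    unfolding kernel_def by (intro Abs_pmf_inverse) (auto intro: D.prob_space_axioms)
qed

lemma pmf_kernel:
  assumes "0 \<le> t"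
  shows "pmf (kernel t x) y = trans_prob Pr X t x y"
proof -
  have "pmf (kernel t x) y = Sigma_Algebra.measure (distr (Pr x) (count_space UNIV) (X t)) {y}"
    by (simp add: measure_kernel[OF assms, symmetric] measure_pmf_single)
  also have "\<dots> = trans_prob Pr X t x y"
    unfolding trans_prob_def using measurable[OF assms]
    by (subst measure_distr) (auto intro!: arg_cong[where f = "Sigma_Algebra.measure (Pr x)"])
  finally show ?thesis .
qed

lemma semigroup_op_kernel:
  assumes "0 \<le> t"
  shows "semigroup_op Pr X t g x = measure_pmf.expectation (kernel t x) g"
  unfolding semigroup_op_def measure_kernel[OF assms]
  by (rule integral_distr[symmetric]) (use measurable[OF assms] in auto)

lemma integrable_kernel_iff:
  fixes g :: "'a \<Rightarrow> real"
  assumes "0 \<le> t"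
  shows "integrable (measure_pmf (kernel t x)) g \<longleftrightarrow> integrable (Pr x) (\<lambda>\<omega>. g (X t \<omega>))"
  unfolding measure_kernel[OF assms]
  by (rule integrable_distr_eq) (use measurable[OF assms] in auto)

lemma sets_fibre:
  assumes "0 \<le> t"
  shows "{\<omega> \<in> space (Pr x). X t \<omega> = y} \<in> sets (Pr x)"
  using measurable_sets[OF measurable[OF assms], of "{y}" x] by (simp add: vimage_def Int_def conj_commute)

lemma kernel_0: "kernel 0 x = return_pmf x"
proof -
  have "AE z in measure_pmf (kernel 0 x). z = x"
    unfolding measure_kernel[OF order_refl]
    using start[of x] measurable[of 0 x] by (subst AE_distr_iff) auto
  then have "set_pmf (kernel 0 x) \<subseteq> {x}"
    by (auto simp: AE_measure_pmf_iff)
  then show ?thesis by (simp add: set_pmf_subset_singleton)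
qed

lemma kernel_add:
  assumes "0 \<le> s" "0 \<le> t"
  shows "kernel (s + t) x = bind_pmf (kernel s x) (kernel t)"
proof (rule pmf_eqI)
  fix z
  interpret prob_space "Pr x" by (rule prob_space)
  let ?E = "\<lambda>y. {\<omega> \<in> space (Pr x). X s \<omega> = y \<and> X (s + t) \<omega> = z}"
  have sets_E: "?E y \<in> sets (Pr x)" for y
  proof -
    have "?E y = {\<omega> \<in> space (Pr x). X s \<omega> = y} \<inter> {\<omega> \<in> space (Pr x). X (s + t) \<omega> = z}"
      by blast
    then show ?thesis using assms by (simp add: sets.Int sets_fibre)
  qed
  \<comment> \<open>The Markov property with no earlier times prescribed.\<close>
  have E: "emeasure (Pr x) (?E y) = ennreal (pmf (kernel s x) y) * ennreal (pmf (kernel t y) z)" for y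
    using markov[of s t "{}" x undefined y z] assms
    by (simp add: emeasure_eq_measure pmf_kernel trans_prob_def ennreal_mult'')
  have "ennreal (pmf (kernel (s + t) x) z) = emeasure (Pr x) (\<Union>y. ?E y)"
    using assms unfolding pmf_kernel[OF add_nonneg_nonneg[OF assms]] trans_prob_def emeasure_eq_measure
    by (intro arg_cong[where f = ennreal] arg_cong[where f = "Sigma_Algebra.measure (Pr x)"]) auto
  also have "\<dots> = (\<integral>\<^sup>+y. emeasure (Pr x) (?E y) \<partial>count_space UNIV)"
    by (rule emeasure_UN_countable) (use sets_E in \<open>auto simp: disjoint_family_on_def\<close>)
  also have "\<dots> = (\<integral>\<^sup>+y. ennreal (pmf (kernel t y) z) \<partial>measure_pmf (kernel s x))"
    by (simp add: E nn_integral_measure_pmf)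
  also have "\<dots> = ennreal (pmf (bind_pmf (kernel s x) (kernel t)) z)"
    by (simp add: ennreal_pmf_bind)
  finally show "pmf (kernel (s + t) x) z = pmf (bind_pmf (kernel s x) (kernel t)) z"
    by simp
qed

sublocale rate_kernel kernel Q
proof
  have stable: "stable_rates Q" using regular by (simp add: regular_rates_def)
  then show "x \<noteq> y \<Longrightarrow> 0 \<le> Q x y" "Q x summable_on (- {x})" for x y
    by (auto simp: stable_rates_def)
  \<comment> \<open>\<open>pmf_kernel\<close> speaks of nonnegative times, which suffices for limits
    from the right.\<close>
  have *: "\<forall>\<^sub>F h in at_right (0::real). 0 \<le> h"
    using eventually_at_right_less[of "0::real"] by eventually_elim simp
  have "((\<lambda>h. pmf (kernel h x) y / h) \<longlongrightarrow> Q x y) (at_right 0)" if "x \<noteq> y" for x y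
  proof (rule Lim_transform_eventually)
    show "((\<lambda>h. trans_prob Pr X h x y / h) \<longlongrightarrow> Q x y) (at_right 0)"
      using rates that by (simp add: has_rates_def)
    show "\<forall>\<^sub>F h in at_right 0. trans_prob Pr X h x y / h = pmf (kernel h x) y / h"
      using * by eventually_elim (simp add: pmf_kernel)
  qed
  moreover have "((\<lambda>h. (1 - pmf (kernel h x) x) / h) \<longlongrightarrow> exit_rate Q x) (at_right 0)" for x
  proof (rule Lim_transform_eventually)
    show "((\<lambda>h. (1 - trans_prob Pr X h x x) / h) \<longlongrightarrow> exit_rate Q x) (at_right 0)"
      using rates by (simp add: has_rates_def)
    show "\<forall>\<^sub>F h in at_right 0. (1 - trans_prob Pr X h x x) / h = (1 - pmf (kernel h x) x) / h"
      using * by eventually_elim (simp add: pmf_kernel)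
  qed
  ultimately show "has_rates (\<lambda>t x. pmf (kernel t x)) Q"
    by (simp add: has_rates_def)
qed (simp_all add: kernel_0 kernel_add)

end

locale curved_chain = regular_markov_chain Pr X Q + admissible_algebra Pr X Q A
  for Pr :: "'a::countable \<Rightarrow> 'w measure" and X :: "real \<Rightarrow> 'w \<Rightarrow> 'a"
    and Q :: "'a \<Rightarrow> 'a \<Rightarrow> real" and A :: "('a \<Rightarrow> real) set" +
  fixes \<rho> :: real
  assumes curvature: "Gamma_curvature_ge Pr X Q A \<rho>"
begin

lemma bounded_memI: "(\<And>z. \<bar>g z\<bar> \<le> B) \<Longrightarrow> g \<in> A"
  by (intro bounded_mem boundedI[of _ B]) auto

lemma A_integrable: "\<lbrakk>g \<in> A; 0 \<le> t\<rbrakk> \<Longrightarrow> integrable (measure_pmf (kernel t x)) g"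
  by (simp add: integrable_kernel_iff semigroup_integrable)

lemma Gam2_mem:
  assumes "f \<in> A" "g \<in> A"
  shows "Gam2 Q f g \<in> A"
proof -
  have "(\<lambda>x. 1 / 2 * (generator Q (\<lambda>z. f z * g z) x
      + (- 1 * (f x * generator Q g x) + - 1 * (g x * generator Q f x)))) \<in> A"
    by (intro add_mem scale_mem mult_mem generator_mem assms)
  also have "(\<lambda>x. 1 / 2 * (generator Q (\<lambda>z. f z * g z) x
      + (- 1 * (f x * generator Q g x) + - 1 * (g x * generator Q f x)))) = Gam2 Q f g"
    by (auto simp: Gam2_def fun_eq_iff)
  finally show ?thesis .
qed

lemma Gam_term_nonneg: "0 \<le> 1 / 2 * ((g z - g y) * (g z - g y) * Q y z)"
  using Q_nonneg[of y z] by (cases "y = z") auto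

lemma Gam_nonneg: "g \<in> A \<Longrightarrow> 0 \<le> Gam Q g y"
  by (rule has_sum_nonneg[OF Gam2_has_sum Gam_term_nonneg])

text \<open>Cauchy-Schwarz for the form \<Gamma>: the quadratic polynomial in \<open>r\<close> is
  \<Gamma> of \<open>v + r * w\<close>, hence nonnegative everywhere.\<close>

lemma Gam2_le:
  assumes v: "v \<in> A" and w: "w \<in> A"
  shows "Gam2 Q v w y \<le> sqrt (Gam Q v y) * sqrt (Gam Q w y)"
proof -
  define a b c where "a = Gam Q v y" and "b = Gam2 Q v w y" and "c = Gam Q w y"
  have nn: "0 \<le> a" "0 \<le> c" using Gam_nonneg v w by (auto simp: a_def c_def)
  have quad: "0 \<le> a + r * (2 * b) + r\<^sup>2 * c" for r
  proof (rule has_sum_nonneg)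
    show "((\<lambda>z. 1 / 2 * ((v z - v y) * (v z - v y) * Q y z)
          + r * (2 * (1 / 2 * ((v z - v y) * (w z - w y) * Q y z)))
          + r\<^sup>2 * (1 / 2 * ((w z - w y) * (w z - w y) * Q y z))) has_sum
        (a + r * (2 * b) + r\<^sup>2 * c)) UNIV"
      unfolding a_def b_def c_def
      by (intro has_sum_add has_sum_cmult_right Gam2_has_sum v w)
    fix z
    have "1 / 2 * ((v z - v y) * (v z - v y) * Q y z)
          + r * (2 * (1 / 2 * ((v z - v y) * (w z - w y) * Q y z)))
          + r\<^sup>2 * (1 / 2 * ((w z - w y) * (w z - w y) * Q y z))
        = 1 / 2 * (((v z + r * w z) - (v y + r * w y)) * ((v z + r * w z) - (v y + r * w y)) * Q y z)"
      by (simp add: algebra_simps power2_eq_square add_divide_distrib diff_divide_distrib)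
    then show "0 \<le> 1 / 2 * ((v z - v y) * (v z - v y) * Q y z)
          + r * (2 * (1 / 2 * ((v z - v y) * (w z - w y) * Q y z)))
          + r\<^sup>2 * (1 / 2 * ((w z - w y) * (w z - w y) * Q y z))"
      using Gam_term_nonneg[of "\<lambda>z. v z + r * w z" z y] by simp
  qed
  have "b\<^sup>2 \<le> a * c"
  proof (cases "c = 0")
    case True
    have "b = 0"
    proof (rule ccontr)
      assume "b \<noteq> 0"
      \<comment> \<open>At this \<open>r\<close> the polynomial has the value
        \<open>a - (a + 1)\<close>, that is -1.\<close>
      then show False
        using quad[of "- (a + 1) / (2 * b)"] by (simp add: True)
    qed
    then show ?thesis using nn by simp
  next
    case False
    then have "0 < c" using nn by simp
    \<comment> \<open>The minimizer of the polynomial; multiplying by \<open>c\<close> clears the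
      denominator.\<close>
    have "0 \<le> (a + (- b / c) * (2 * b) + (- b / c)\<^sup>2 * c) * c"
      using quad[of "- b / c"] nn by simp
    also have "\<dots> = a * c - b\<^sup>2"
      using \<open>0 < c\<close> by (simp add: power2_eq_square field_simps)
    finally show ?thesis by simp
  qed
  then have "b \<le> sqrt (a * c)"
    by (rule real_le_rsqrt)
  then show ?thesis by (simp add: a_def b_def c_def real_sqrt_mult)
qed

text \<open>The exit rate is not itself given as a member of \<open>A\<close>. Sign functions are
  bounded, so their generators lie in \<open>A\<close> and are integrable.\<close>

lemma exit_rate_integrable:
  assumes "0 \<le> s"
  shows "integrable (measure_pmf (kernel s x)) q"
proof (rule integrable_exit_rate)
  fix e :: "'a \<Rightarrow> real" assume e: "\<And>z. e z \<in> {-1, 1}"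
  have "\<bar>e z\<bar> \<le> 1" for z using e[of z] by auto
  then show "integrable (measure_pmf (kernel s x)) (generator Q e)"
    by (intro A_integrable generator_mem bounded_memI assms)
qed

lemma curvature_kernel:
  assumes "g \<in> A" "0 < r"
  shows "sqrt (Gam Q (P r g) y) \<le> exp (- \<rho> * r) * P r (\<lambda>z. sqrt (Gam Q g z)) y"
proof -
  have "semigroup_op Pr X r h = P r h" for h
    using assms by (simp add: fun_eq_iff semigroup_op_kernel)
  moreover have "sqrt (Gam Q (semigroup_op Pr X r g) y)
      \<le> exp (- \<rho> * r) * semigroup_op Pr X r (\<lambda>z. sqrt (Gam Q g z)) y"
    using curvature assms unfolding Gamma_curvature_ge_def by blast
  ultimately show ?thesis by simp
qed

text \<open>The bounds on \<open>g\<close> and \<open>k\<close> differ on purpose: one proportional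
  to \<open>k\<close> survives averaging, as \<open>P s (P r k)\<close> is \<open>P t k\<close> for
  every splitting of \<open>t\<close>. The factor \<open>P t k x\<close> is the one that Herbst's
  argument divides out.\<close>

lemma covar_curvature:
  assumes g: "\<And>z. \<bar>g z\<bar> \<le> B" and k: "\<And>z. \<bar>k z\<bar> \<le> C" and "0 < t"
    and nn: "0 \<le> a" "0 \<le> b"
    and Gam_g: "\<And>z. Gam Q g z \<le> a\<^sup>2" and Gam_k: "\<And>z. sqrt (Gam Q k z) \<le> b * k z"
  shows "covar t g k x \<le> 2 * (a * b) * P t k x * L_const t \<rho>"
proof (rule covar_le[OF g k \<open>0 < t\<close> exit_rate_integrable])
  fix s assume s: "0 \<le> s" "s < t"
  define r where "r = t - s"
  then have r: "0 < r" using s by simp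
  define v w where "v = P r g" and "w = P r k"
  have gA: "g \<in> A" and kA: "k \<in> A" using bounded_memI g k by auto
  have vA: "v \<in> A" and wA: "w \<in> A"
    unfolding v_def w_def by (rule bounded_memI[OF P_bounded[OF g]] bounded_memI[OF P_bounded[OF k]])+
  have v: "sqrt (Gam Q v y) \<le> exp (- \<rho> * r) * a" for y
  proof -
    have Gam_g': "sqrt (Gam Q g z) \<le> a" for z
      using real_sqrt_le_mono[OF Gam_g[of z]] nn by simp
    have "\<bar>sqrt (Gam Q g z)\<bar> \<le> a" for z
      using Gam_g'[of z] Gam_nonneg[OF gA, of z] by simp
    then have "P r (\<lambda>z. sqrt (Gam Q g z)) y \<le> a"
      by (rule abs_le_D1[OF P_bounded])
    then show ?thesis
      using curvature_kernel[OF gA r, of y] unfolding v_def by (meson exp_ge_zero mult_left_mono order_trans)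
  qed
  have w: "sqrt (Gam Q w y) \<le> exp (- \<rho> * r) * (b * w y)" for y
  proof -
    have k': "\<bar>b * k z\<bar> \<le> b * C" for z
      using k[of z] nn by (simp add: abs_mult mult_left_mono)
    have "\<bar>sqrt (Gam Q k z)\<bar> \<le> b * C" for z
      using Gam_k[of z] Gam_nonneg[OF kA, of z] k'[of z] by simp
    then have "P r (\<lambda>z. sqrt (Gam Q k z)) y \<le> P r (\<lambda>z. b * k z) y"
      by (intro integral_mono integrable_pmf_bounded[OF k'] integrable_pmf_bounded[of _ "b * C"] Gam_k)
    also have "\<dots> = b * w y" by (simp add: w_def)
    finally show ?thesis
      using curvature_kernel[OF kA r, of y] unfolding w_def by (meson exp_ge_zero mult_left_mono order_trans)
  qed
  have pointwise: "2 * Gam2 Q v w y \<le> 2 * (a * b) * exp (- 2 * \<rho> * r) * w y" for y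
  proof -
    have "Gam2 Q v w y \<le> sqrt (Gam Q v y) * sqrt (Gam Q w y)" by (rule Gam2_le[OF vA wA])
    also have "\<dots> \<le> (exp (- \<rho> * r) * a) * (exp (- \<rho> * r) * (b * w y))"
      using nn Gam_nonneg[OF wA] by (intro mult_mono v w) auto
    also have "\<dots> = (a * b) * (exp (- \<rho> * r) * exp (- \<rho> * r)) * w y" by (simp add: algebra_simps)
    also have "exp (- \<rho> * r) * exp (- \<rho> * r) = exp (- 2 * \<rho> * r)"
      by (simp add: exp_add[symmetric])
    finally show ?thesis by simp
  qed
  have "(\<Sum>\<^sub>\<infinity>z. (v z - v y) * (w z - w y) * Q y z) = 2 * Gam2 Q v w y" for y
    using infsumI[OF has_sum_cmult_right[OF Gam2_has_sum[OF vA wA, of y], of 2]] by simp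
  then have "P s (\<lambda>y. \<Sum>\<^sub>\<infinity>z. (v z - v y) * (w z - w y) * Q y z) x = P s (\<lambda>y. 2 * Gam2 Q v w y) x"
    by simp
  also have "\<dots> \<le> P s (\<lambda>y. 2 * (a * b) * exp (- 2 * \<rho> * r) * w y) x"
    using s by (intro integral_mono pointwise integrable_mult_right A_integrable Gam2_mem vA wA)
  also have "\<dots> = 2 * (a * b) * P t k x * exp (- 2 * \<rho> * r)"
    using P_add[OF k, of s r x] s r by (simp add: w_def r_def)
  finally show "P s (\<lambda>y. \<Sum>\<^sub>\<infinity>z. (P (t - s) g z - P (t - s) g y) * (P (t - s) k z - P (t - s) k y) * Q y z) x
      \<le> 2 * (a * b) * P t k x * exp (- 2 * \<rho> * (t - s))"
    by (simp add: v_def w_def r_def)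
qed

end

section \<open>Deviation of Lipschitz functions\<close>

text \<open>Chords of a convex function issuing from 0 get steeper: \<open>a\<close> is the convex
  combination of 0 and \<open>b\<close> with weight \<open>a / b\<close>.\<close>

lemma exp_slope_mono:
  fixes a b \<theta> :: real
  assumes "0 < a" "a \<le> b"
  shows "(exp (\<theta> * a) - 1) / a \<le> (exp (\<theta> * b) - 1) / b"
proof -
  define c where "c = a / b"
  have c: "0 < c" "c \<le> 1" "a = c * b" "0 < b" using assms by (auto simp: c_def)
  have "exp ((1 - c) *\<^sub>R 0 + c *\<^sub>R (\<theta> * b)) \<le> (1 - c) * exp 0 + c * exp (\<theta> * b)"
    using c by (intro convex_onD[OF exp_convex]) auto
  then have "exp (\<theta> * a) - 1 \<le> c * (exp (\<theta> * b) - 1)"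
    by (simp add: c(3) algebra_simps)
  then have "(exp (\<theta> * a) - 1) / a \<le> c * (exp (\<theta> * b) - 1) / a"
    using assms by (intro divide_right_mono) auto
  also have "\<dots> = (exp (\<theta> * b) - 1) / b" using c by (simp add: c(3))
  finally show ?thesis .
qed

lemma abs_exp_minus_one_le_exp_abs: "\<bar>exp x - 1\<bar> \<le> exp \<bar>x\<bar> - 1" for x :: real
proof (cases "0 \<le> x")
  case False
  then have "\<bar>x\<bar> = - x" "exp x < 1" by simp_all
  then show ?thesis
    using exp_ge_add_one_self[of x] exp_ge_add_one_self[of "- x"] by linarith
qed simp

text \<open>Origin of the weight in \<open>psi\<close>: \<open>u\<close> will be an increment of a
  contraction of \<open>f\<close>, \<open>a\<close> the same increment of \<open>f\<close>, and
  \<open>b\<close> its Lipschitz bound. The factor \<open>a\<^sup>2\<close> is kept; only the slope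
  of the exponential is enlarged from its value at \<open>\<bar>a\<bar>\<close> to that at
  \<open>b\<close>.\<close>

lemma exp_increment_bound:
  fixes \<theta> u a b :: real
  assumes "0 \<le> \<theta>" "\<bar>u\<bar> \<le> \<bar>a\<bar>" "\<bar>a\<bar> \<le> b"
  shows "(exp (\<theta> * u) - 1)\<^sup>2 \<le> a\<^sup>2 * ((exp (\<theta> * b) - 1) / b)\<^sup>2"
proof (cases "a = 0")
  case False
  have "\<bar>exp (\<theta> * u) - 1\<bar> \<le> exp \<bar>\<theta> * u\<bar> - 1" by (rule abs_exp_minus_one_le_exp_abs)
  also have "\<dots> \<le> exp (\<theta> * \<bar>a\<bar>) - 1"
    using assms by (simp add: abs_mult mult_left_mono)
  also have "\<dots> = \<bar>a\<bar> * ((exp (\<theta> * \<bar>a\<bar>) - 1) / \<bar>a\<bar>)" using False by simp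
  also have "\<dots> \<le> \<bar>a\<bar> * ((exp (\<theta> * b) - 1) / b)"
    using assms False by (intro mult_left_mono exp_slope_mono) auto
  finally have "\<bar>exp (\<theta> * u) - 1\<bar>\<^sup>2 \<le> (\<bar>a\<bar> * ((exp (\<theta> * b) - 1) / b))\<^sup>2"
    by (intro power_mono) auto
  then show ?thesis unfolding power_mult_distrib power2_abs .
qed (use assms in simp)

lemma sqrt_ennreal_mono: "a \<le> b \<Longrightarrow> sqrt_ennreal a \<le> sqrt_ennreal b"
  unfolding sqrt_ennreal_def
  by (auto simp: top_unique less_top intro!: ennreal_leI enn2real_mono)

lemma sqrt_ennreal_ennreal: "0 \<le> r \<Longrightarrow> sqrt_ennreal (ennreal r) = ennreal (sqrt r)"
  by (simp add: sqrt_ennreal_def)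

lemma L_const_pos:
  assumes "0 < t"
  shows "0 < L_const t \<rho>"
proof -
  consider "\<rho> = 0" | "0 < \<rho>" | "\<rho> < 0" by linarith
  then show ?thesis
  proof cases
    case 2
    then show ?thesis using assms by (simp add: L_const_def)
  next
    case 3
    then have "0 < - 2 * \<rho> * t" using assms by (simp add: mult_neg_pos)
    then have "1 - exp (- 2 * \<rho> * t) < 0" by simp
    with 3 show ?thesis by (simp add: L_const_def divide_neg_neg)
  qed (use assms in \<open>simp add: L_const_def\<close>)
qed

lemma smooth_exp: "smooth (\<lambda>x. exp (c * x))"
proof -
  have deriv: "((\<lambda>x. c ^ n * exp (c * x)) has_real_derivative c ^ Suc n * exp (c * x)) (at x)" for n x
    by (auto intro!: derivative_eq_intros)
  have "(deriv ^^ n) (\<lambda>x::real. exp (c * x)) = (\<lambda>x. c ^ n * exp (c * x))" for n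
  proof (induction n)
    case (Suc n)
    show ?case unfolding funpow.simps o_apply Suc by (rule ext) (rule DERIV_imp_deriv[OF deriv])
  qed simp
  then show ?thesis
    unfolding smooth_def using deriv by (metis real_differentiable_def)
qed

section \<open>Weights and constants of the deviation function\<close>

definition weight :: "('a \<Rightarrow> 'a \<Rightarrow> real) \<Rightarrow> ('a \<Rightarrow> 'a \<Rightarrow> real) \<Rightarrow> ('a \<Rightarrow> real) \<Rightarrow> real \<Rightarrow> 'a \<Rightarrow> 'a \<Rightarrow> real"
where
  "weight d Q f \<theta> x y = (f y - f x)\<^sup>2 *
     ((exp (\<theta> * enn2real (Lip_norm d f) * d x y) - 1) / (enn2real (Lip_norm d f) * d x y))\<^sup>2 * Q x y"

definition weight_sup :: "('a \<Rightarrow> 'a \<Rightarrow> real) \<Rightarrow> ('a \<Rightarrow> 'a \<Rightarrow> real) \<Rightarrow> ('a \<Rightarrow> real) \<Rightarrow> real \<Rightarrow> ennreal" where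
  "weight_sup d Q f \<theta> = (SUP x. \<Sum>\<^sub>\<infinity>y. ennreal (weight d Q f \<theta> x y))"

lemma psi_weight_sup: "psi d Q \<rho> f t \<theta> =
    ennreal (sqrt 2 * L_const t \<rho>) * sqrt_ennreal (sup_norm (Gam Q f)) * sqrt_ennreal (weight_sup d Q f \<theta>)"
  by (simp add: psi_def weight_sup_def weight_def)

locale Lipschitz_observable = curved_chain Pr X Q A \<rho>
  for Pr :: "'a::countable \<Rightarrow> 'w measure" and X :: "real \<Rightarrow> 'w \<Rightarrow> 'a"
    and Q :: "'a \<Rightarrow> 'a \<Rightarrow> real" and A :: "('a \<Rightarrow> real) set" and \<rho> :: real +
  fixes d :: "'a \<Rightarrow> 'a \<Rightarrow> real" and f :: "'a \<Rightarrow> real" and t :: real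
  assumes metric: "Metric_space UNIV d" and f_mem: "f \<in> A" and f_Lip: "f \<in> Lip d"
    and Gam_finite: "sup_norm (Gam Q f) < \<infinity>" and t_pos: "0 < t"
begin

abbreviation l :: real where "l \<equiv> enn2real (Lip_norm d f)"

definition k :: real where "k = sqrt (enn2real (sup_norm (Gam Q f)))"

text \<open>Halved because of the 1/2 in \<Gamma>: \<open>b \<theta>\<close> will bound sqrt
  \<Gamma>(exp(\<theta> g)) relative to exp(\<theta> g) for bounded contractions \<open>g\<close> of
  \<open>f\<close>.\<close>

definition b :: "real \<Rightarrow> real" where "b \<theta> = sqrt (enn2real (weight_sup d Q f \<theta>) / 2)"

abbreviation \<psi> :: "real \<Rightarrow> ennreal" where "\<psi> \<equiv> psi d Q \<rho> f t"

lemma d_nonneg: "0 \<le> d y z"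
  using metric by (simp add: Metric_space_def)

lemma f_increment: "\<bar>f z - f y\<bar> \<le> l * d y z"
proof (cases "y = z")
  case False
  then have "0 < d y z" using metric d_nonneg[of y z] by (auto simp: Metric_space_def less_le)
  have "ennreal (\<bar>f y - f z\<bar> / d y z) \<le> Lip_norm d f"
    unfolding Lip_norm_def by (rule SUP_upper2[of "(y, z)"]) (use False in auto)
  also have "\<dots> = ennreal l" using f_Lip by (simp add: Lip_def)
  finally have "\<bar>f y - f z\<bar> / d y z \<le> l" by simp
  then show ?thesis using \<open>0 < d y z\<close> by (simp add: pos_divide_le_eq abs_minus_commute)
qed (use d_nonneg in simp)

lemma weight_nonneg: "0 \<le> weight d Q f \<theta> y z"
  using Q_nonneg[of y z] by (cases "y = z") (auto simp: weight_def)

lemma weight_mono: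
  assumes "0 \<le> s" "s \<le> \<theta>"
  shows "weight d Q f s y z \<le> weight d Q f \<theta> y z"
proof (cases "y = z")
  case False
  have ld: "0 \<le> l * d y z" using d_nonneg by simp
  have "s * l * d y z \<le> \<theta> * l * d y z"
    using mult_right_mono[OF assms(2) ld] by (simp add: mult.assoc)
  moreover have "0 \<le> s * l * d y z" using assms ld by (simp add: mult.assoc)
  ultimately show ?thesis unfolding weight_def using ld Q_nonneg[OF False]
    by (intro mult_right_mono mult_left_mono power_mono divide_right_mono divide_nonneg_nonneg) auto
qed (simp add: weight_def)

lemma weight_sup_mono:
  assumes "0 \<le> s" "s \<le> \<theta>"
  shows "weight_sup d Q f s \<le> weight_sup d Q f \<theta>"
  unfolding weight_sup_def
  by (intro SUP_mono' infsum_mono nonneg_summable_on_complete ennreal_leI weight_mono assms) auto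

lemma psi_mono: "\<lbrakk>0 \<le> s; s \<le> \<theta>\<rbrakk> \<Longrightarrow> \<psi> s \<le> \<psi> \<theta>"
  unfolding psi_weight_sup by (intro mult_left_mono sqrt_ennreal_mono weight_sup_mono) auto

text \<open>\<open>enn2real\<close> sends \<infinity> to 0, so monotonicity relies on finiteness at
  the right end.\<close>

lemma psi_mono_on:
  assumes "\<psi> \<theta> < \<infinity>"
  shows "mono_on {0..\<theta>} (\<lambda>\<tau>. enn2real (\<psi> \<tau>))"
proof (rule mono_onI)
  fix r s assume "r \<in> {0..\<theta>}" "s \<in> {0..\<theta>}" "r \<le> s"
  then show "enn2real (\<psi> r) \<le> enn2real (\<psi> s)"
    using psi_mono[of r s] le_less_trans[OF psi_mono[of s \<theta>] assms] by (intro enn2real_mono) auto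
qed

lemma k_nonneg: "0 \<le> k" and b_nonneg: "0 \<le> b \<theta>"
  by (simp_all add: k_def b_def)

lemma Gam_le: "Gam Q f z \<le> k\<^sup>2"
proof -
  have "ennreal \<bar>Gam Q f z\<bar> \<le> sup_norm (Gam Q f)"
    unfolding sup_norm_def by (rule SUP_upper) simp
  also have "\<dots> = ennreal (k\<^sup>2)" using Gam_finite by (simp add: k_def)
  finally show ?thesis by simp
qed

text \<open>A finite product could hide an infinite factor behind 0 * \<infinity> = 0. That requires
  \<open>k = 0\<close>; but then \<Gamma> f = 0, so \<open>f\<close> is unchanged along transitions
  of positive rate and every weight vanishes.\<close>

lemma weight_sup_finite:
  assumes "\<psi> \<theta> < \<infinity>"
  shows "weight_sup d Q f \<theta> < \<infinity>"
proof (rule ccontr)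
  assume "\<not> weight_sup d Q f \<theta> < \<infinity>"
  then have top: "weight_sup d Q f \<theta> = \<infinity>" by (simp add: less_top[symmetric])
  have L: "0 < sqrt 2 * L_const t \<rho>" using L_const_pos[OF t_pos] by simp
  have "sup_norm (Gam Q f) = ennreal (k\<^sup>2)" using Gam_finite by (simp add: k_def)
  then have psi: "\<psi> \<theta> = ennreal (sqrt 2 * L_const t \<rho>) * ennreal k * \<infinity>"
    using k_nonneg unfolding psi_weight_sup top by (simp add: sqrt_ennreal_ennreal) (simp add: sqrt_ennreal_def)
  have "k = 0"
  proof (rule ccontr)
    assume "k \<noteq> 0"
    then have "\<psi> \<theta> = \<infinity>"
      using L_const_pos[OF t_pos, of \<rho>] L k_nonneg unfolding psi by (simp add: ennreal_mult_top ennreal_mult_eq_top_iff)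
    then show False using assms by simp
  qed
  have "weight d Q f \<theta> y z = 0" for y z
  proof -
    have "Gam Q f y = 0" using Gam_le[of y] Gam_nonneg[OF f_mem, of y] \<open>k = 0\<close> by simp
    then have "1 / 2 * ((f z - f y) * (f z - f y) * Q y z) = 0"
      using nonneg_has_sum_le_0D[OF Gam2_has_sum[OF f_mem f_mem, of y] _ Gam_term_nonneg] by simp
    then show ?thesis by (auto simp: weight_def)
  qed
  then show False using top by (simp add: weight_sup_def)
qed

lemma psi_eq:
  assumes "\<psi> \<theta> < \<infinity>"
  shows "enn2real (\<psi> \<theta>) = 2 * (k * b \<theta>) * L_const t \<rho>"
proof -
  define s where "s = enn2real (weight_sup d Q f \<theta>)"
  have "0 \<le> s" by (simp add: s_def)
  have "weight_sup d Q f \<theta> = ennreal s" using weight_sup_finite[OF assms] by (simp add: s_def)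
  moreover have "sup_norm (Gam Q f) = ennreal (k\<^sup>2)" using Gam_finite by (simp add: k_def)
  ultimately have "\<psi> \<theta> = ennreal (sqrt 2 * L_const t \<rho>) * ennreal k * ennreal (sqrt s)"
    using k_nonneg \<open>0 \<le> s\<close> by (simp add: psi_weight_sup sqrt_ennreal_ennreal)
  also have "\<dots> = ennreal (sqrt 2 * L_const t \<rho> * k * sqrt s)"
    using L_const_pos[OF t_pos, of \<rho>] k_nonneg \<open>0 \<le> s\<close> by (simp add: ennreal_mult)
  finally have "enn2real (\<psi> \<theta>) = sqrt 2 * L_const t \<rho> * k * sqrt s"
    using L_const_pos[OF t_pos, of \<rho>] k_nonneg \<open>0 \<le> s\<close> by simp
  \<comment> \<open>This sqrt 2 and the one in \<open>psi\<close> make up the factor 2 of the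
    covariance bound.\<close>
  also have "sqrt s = sqrt 2 * b \<theta>"
    by (simp add: b_def s_def real_sqrt_mult[symmetric])
  finally show ?thesis by simp
qed

lemma weight_sum_le:
  assumes "\<psi> \<theta> < \<infinity>" "finite F"
  shows "(\<Sum>z\<in>F. weight d Q f \<theta> y z) \<le> 2 * (b \<theta>)\<^sup>2"
proof -
  have "ennreal (\<Sum>z\<in>F. weight d Q f \<theta> y z) = (\<Sum>z\<in>F. ennreal (weight d Q f \<theta> y z))"
    by (simp add: weight_nonneg)
  also have "\<dots> \<le> (\<Sum>\<^sub>\<infinity>z. ennreal (weight d Q f \<theta> y z))"
    by (subst nonneg_infsum_complete) (use assms in \<open>auto intro!: SUP_upper\<close>)
  also have "\<dots> \<le> weight_sup d Q f \<theta>"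
    unfolding weight_sup_def by (rule SUP_upper) simp
  also have "\<dots> = ennreal (2 * (b \<theta>)\<^sup>2)"
    using weight_sup_finite[OF assms(1)] by (simp add: b_def)
  finally show ?thesis by (simp add: ennreal_le_iff)
qed

section \<open>Bounded contractions of the observable\<close>

context
  fixes g :: "'a \<Rightarrow> real" and B :: real
  assumes g: "\<And>z. \<bar>g z\<bar> \<le> B" and contraction: "\<And>y z. \<bar>g z - g y\<bar> \<le> \<bar>f z - f y\<bar>"
begin

lemma Gam_contraction: "Gam Q g y \<le> k\<^sup>2"
proof -
  have "Gam Q g y \<le> Gam Q f y"
  proof (rule has_sum_mono[OF Gam2_has_sum Gam2_has_sum])
    fix z
    have "(g z - g y) * (g z - g y) \<le> (f z - f y) * (f z - f y)"
      using contraction[of z y] by (simp add: abs_le_square_iff power2_eq_square)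
    then show "1 / 2 * ((g z - g y) * (g z - g y) * Q y z) \<le> 1 / 2 * ((f z - f y) * (f z - f y) * Q y z)"
      using Q_nonneg[of y z] by (cases "y = z") (auto intro: mult_right_mono)
  qed (use f_mem bounded_memI[OF g] in auto)
  with Gam_le[of y] show ?thesis by simp
qed

text \<open>The factor \<open>exp (\<theta> * g y)\<close> comes out of the increments, and
  \<open>exp_increment_bound\<close> controls the rest by the weight of \<open>f\<close>. The bound
  is proportional to the function itself, as \<open>covar_curvature\<close> requires.\<close>

lemma Gam_exp_contraction:
  assumes "0 \<le> \<theta>" "\<psi> \<theta> < \<infinity>"
  shows "sqrt (Gam Q (\<lambda>z. exp (\<theta> * g z)) y) \<le> b \<theta> * exp (\<theta> * g y)"
proof -
  have mem: "(\<lambda>z. exp (\<theta> * g z)) \<in> A" by (rule bounded_memI) (rule exp_bounded[OF g])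
  have term_le: "1 / 2 * ((exp (\<theta> * g z) - exp (\<theta> * g y)) * (exp (\<theta> * g z) - exp (\<theta> * g y)) * Q y z)
      \<le> (exp (\<theta> * g y))\<^sup>2 / 2 * weight d Q f \<theta> y z" for z
  proof (cases "y = z")
    case False
    have "exp (\<theta> * g z) - exp (\<theta> * g y) = exp (\<theta> * g y) * (exp (\<theta> * (g z - g y)) - 1)"
      by (simp add: exp_diff right_diff_distrib)
    then have "1 / 2 * ((exp (\<theta> * g z) - exp (\<theta> * g y)) * (exp (\<theta> * g z) - exp (\<theta> * g y)) * Q y z)
        = (exp (\<theta> * g y))\<^sup>2 / 2 * ((exp (\<theta> * (g z - g y)) - 1)\<^sup>2 * Q y z)"
      by (simp add: power2_eq_square)
    also have "\<dots> \<le> (exp (\<theta> * g y))\<^sup>2 / 2 * weight d Q f \<theta> y z"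
      using exp_increment_bound[OF assms(1) contraction f_increment, of z y] Q_nonneg[OF False]
      unfolding weight_def by (intro mult_left_mono mult_right_mono) (auto simp: mult.assoc)
    finally show ?thesis .
  qed (simp add: weight_def)
  have "Gam Q (\<lambda>z. exp (\<theta> * g z)) y \<le> (b \<theta> * exp (\<theta> * g y))\<^sup>2"
  proof (rule has_sum_le_finite_sums[OF Gam2_has_sum[OF mem mem]])
    fix F :: "'a set" assume "finite F"
    have "(\<Sum>z\<in>F. 1 / 2 * ((exp (\<theta> * g z) - exp (\<theta> * g y)) * (exp (\<theta> * g z) - exp (\<theta> * g y)) * Q y z))
        \<le> (\<Sum>z\<in>F. (exp (\<theta> * g y))\<^sup>2 / 2 * weight d Q f \<theta> y z)"
      by (intro sum_mono term_le)
    also have "\<dots> = (exp (\<theta> * g y))\<^sup>2 / 2 * (\<Sum>z\<in>F. weight d Q f \<theta> y z)"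
      by (simp add: sum_distrib_left)
    also have "\<dots> \<le> (exp (\<theta> * g y))\<^sup>2 / 2 * (2 * (b \<theta>)\<^sup>2)"
      using weight_sum_le[OF assms(2) \<open>finite F\<close>] by (intro mult_left_mono) auto
    finally show "(\<Sum>z\<in>F. 1 / 2 * ((exp (\<theta> * g z) - exp (\<theta> * g y)) * (exp (\<theta> * g z) - exp (\<theta> * g y)) * Q y z))
        \<le> (b \<theta> * exp (\<theta> * g y))\<^sup>2"
      by (simp add: power_mult_distrib mult.commute)
  qed
  then show ?thesis
    by (rule real_le_lsqrt[rotated]) (simp add: b_nonneg)
qed

lemma mgf_contraction:
  assumes "0 \<le> \<theta>" "\<psi> \<theta> < \<infinity>"
  shows "P t (\<lambda>z. exp (\<theta> * g z)) x
    \<le> exp (\<theta> * P t g x + (LBINT \<tau>:{0..\<theta>}. enn2real (\<psi> \<tau>)))"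
proof (rule herbst[OF g \<open>0 \<le> \<theta>\<close>])
  show "mono_on {0..\<theta>} (\<lambda>\<tau>. enn2real (\<psi> \<tau>))" by (rule psi_mono_on[OF assms(2)])
  fix s assume s: "0 \<le> s" "s < \<theta>"
  then have fin: "\<psi> s < \<infinity>" using le_less_trans[OF psi_mono[of s \<theta>] assms(2)] by simp
  have "covar t g (\<lambda>z. exp (s * g z)) x
      \<le> 2 * (k * b s) * P t (\<lambda>z. exp (s * g z)) x * L_const t \<rho>"
    by (rule covar_curvature[where C = "exp (\<bar>s\<bar> * B)"])
       (rule g exp_bounded[OF g] t_pos k_nonneg b_nonneg Gam_contraction Gam_exp_contraction[OF s(1) fin])+
  then show "P t (\<lambda>z. g z * exp (s * g z)) x - P t g x * P t (\<lambda>z. exp (s * g z)) x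
      \<le> enn2real (\<psi> s) * P t (\<lambda>z. exp (s * g z)) x"
    by (simp add: covar_def psi_eq[OF fin] mult_ac)
qed

end

text \<open>The bound for a truncation involves \<open>psi\<close> of \<open>f\<close> itself and so
  is the same for all \<open>n\<close>; only the two expectations have to pass to the limit.\<close>

lemma mgf_bound:
  assumes "0 \<le> \<theta>" "\<psi> \<theta> < \<infinity>"
  shows "P t (\<lambda>z. exp (\<theta> * f z)) x
    \<le> exp (\<theta> * P t f x + (LBINT \<tau>:{0..\<theta>}. enn2real (\<psi> \<tau>)))"
proof -
  define g where "g n z = max (- real n) (min (real n) (f z))" for n z
  have g: "\<bar>g n z\<bar> \<le> real n" and contraction: "\<bar>g n z - g n y\<bar> \<le> \<bar>f z - f y\<bar>"
    and dom: "\<bar>g n z\<bar> \<le> \<bar>f z\<bar>" for n y z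
    by (auto simp: g_def max_def min_def)
  have lim: "(\<lambda>n. g n z) \<longlonglongrightarrow> f z" for z
  proof (rule tendsto_eventually)
    obtain N :: nat where "\<bar>f z\<bar> \<le> real N" using real_arch_simple by blast
    then show "\<forall>\<^sub>F n in sequentially. g n z = f z"
      by (intro eventually_sequentiallyI[of N]) (auto simp: g_def)
  qed
  have "(\<lambda>n. P t (g n) x) \<longlonglongrightarrow> P t f x"
    by (rule integral_dominated_convergence[where w = "\<lambda>z. \<bar>f z\<bar>"])
       (use t_pos lim dom f_mem in \<open>auto intro!: integrable_abs A_integrable\<close>)
  then have upper: "(\<lambda>n. exp (\<theta> * P t (g n) x + (LBINT \<tau>:{0..\<theta>}. enn2real (\<psi> \<tau>))))
      \<longlonglongrightarrow> exp (\<theta> * P t f x + (LBINT \<tau>:{0..\<theta>}. enn2real (\<psi> \<tau>)))"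
    by (intro tendsto_intros)
  have lower: "(\<lambda>n. P t (\<lambda>z. exp (\<theta> * g n z)) x) \<longlonglongrightarrow> P t (\<lambda>z. exp (\<theta> * f z)) x"
  \<comment> \<open>A truncated value lies between 0 and \<open>f z\<close>, so its exponential is
    at most 1 or \<open>exp (\<theta> * f z)\<close>. The latter is integrable since
    \<open>A\<close> is stable under smooth maps.\<close>
  proof (rule integral_dominated_convergence[where w = "\<lambda>z. 1 + exp (\<theta> * f z)"])
    show "integrable (measure_pmf (kernel t x)) (\<lambda>z. 1 + exp (\<theta> * f z))"
      using smooth_mem[OF f_mem smooth_exp] t_pos bounded_memI[of "\<lambda>_. 1" 1]
      by (intro Bochner_Integration.integrable_add A_integrable) auto
    have "exp (\<theta> * g n z) \<le> 1 + exp (\<theta> * f z)" for n z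
    proof (cases "0 \<le> f z")
      case True
      then have "g n z \<le> f z" by (auto simp: g_def)
      then have "exp (\<theta> * g n z) \<le> exp (\<theta> * f z)" using assms by (simp add: mult_left_mono)
      then show ?thesis by linarith
    next
      case False
      then have "g n z \<le> 0" by (auto simp: g_def)
      then have "exp (\<theta> * g n z) \<le> 1" using assms by (simp add: mult_nonneg_nonpos)
      then show ?thesis by (simp add: add_increasing2)
    qed
    then show "AE z in measure_pmf (kernel t x). norm (exp (\<theta> * g n z)) \<le> 1 + exp (\<theta> * f z)" for n
      by simp
    show "AE z in measure_pmf (kernel t x). (\<lambda>n. exp (\<theta> * g n z)) \<longlonglongrightarrow> exp (\<theta> * f z)"
      by (intro AE_I2 tendsto_intros lim)
  qed auto
  show ?thesis
    by (rule LIMSEQ_le[OF lower upper]) (use mgf_contraction[OF g contraction assms] in auto)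
qed

lemma deviation:
  assumes "0 < \<theta>" "\<psi> \<theta> < \<infinity>"
  shows "Sigma_Algebra.measure (Pr x) {\<omega> \<in> space (Pr x). f (X t \<omega>) - (\<integral>\<omega>'. f (X t \<omega>') \<partial>Pr x) \<ge> y}
    \<le> exp (LBINT \<tau>:{0..\<theta>}. (enn2real (\<psi> \<tau>) - y))"
proof -
  interpret prob_space "Pr x" by (rule prob_space)
  let ?m = "\<integral>\<omega>'. f (X t \<omega>') \<partial>Pr x"
  let ?I = "LBINT \<tau>:{0..\<theta>}. enn2real (\<psi> \<tau>)"
  have t0: "0 \<le> t" using t_pos by simp
  have m: "?m = P t f x" using semigroup_op_kernel[OF t0, of f x] by (simp add: semigroup_op_def)
  have int: "integrable (Pr x) (\<lambda>\<omega>. exp (\<theta> * f (X t \<omega>)))"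
    using semigroup_integrable[OF smooth_mem[OF f_mem smooth_exp] t0] .
  have set_int: "set_integrable (Pr x) (space (Pr x)) (\<lambda>\<omega>. exp (\<theta> * f (X t \<omega>)))"
    unfolding set_integrable_def by (rule integrable_mult_indicator[OF sets.top int])
  have "Sigma_Algebra.measure (Pr x) {\<omega> \<in> space (Pr x). f (X t \<omega>) - ?m \<ge> y}
      = Sigma_Algebra.measure (Pr x) {\<omega> \<in> space (Pr x). f (X t \<omega>) \<ge> y + ?m}"
    by (simp add: le_diff_eq)
  also have "\<dots> \<le> exp (- \<theta> * (y + ?m)) * (\<integral>\<omega>\<in>space (Pr x). exp (\<theta> * f (X t \<omega>)) \<partial>Pr x)"
    by (rule Chernoff_ineq_ge[OF assms(1) set_int sets.top])
  also have "(\<integral>\<omega>\<in>space (Pr x). exp (\<theta> * f (X t \<omega>)) \<partial>Pr x) = P t (\<lambda>z. exp (\<theta> * f z)) x"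
    using semigroup_op_kernel[OF t0, of "\<lambda>z. exp (\<theta> * f z)" x]
    by (simp add: set_integral_space[OF int] semigroup_op_def)
  also have "exp (- \<theta> * (y + ?m)) * P t (\<lambda>z. exp (\<theta> * f z)) x
      \<le> exp (- \<theta> * (y + ?m)) * exp (\<theta> * ?m + ?I)"
    unfolding m using assms by (intro mult_left_mono mgf_bound) auto
  also have "\<dots> = exp (?I - \<theta> * y)"
    by (simp add: exp_add[symmetric] algebra_simps)
  also have "?I - \<theta> * y = (LBINT \<tau>:{0..\<theta>}. (enn2real (\<psi> \<tau>) - y))"
  proof -
    have "set_integrable lborel {0..\<theta>} (\<lambda>\<tau>. enn2real (\<psi> \<tau>))"
      by (rule set_integrable_mono_on[OF psi_mono_on[OF assms(2)]])
    moreover have "set_integrable lborel {0..\<theta>} (\<lambda>_. y)"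
      by (rule set_integrable_mono_on) (simp add: mono_on_def)
    moreover have "(LBINT \<tau>:{0..\<theta>}. y) = \<theta> * y"
      using assms by (simp add: set_lebesgue_integral_def)
    ultimately show ?thesis by (simp add: set_integral_diff)
  qed
  finally show ?thesis .
qed

end

text \<open>For positive \<open>r\<close>, \<open>ln r\<close> is a lower bound of the exponents, so
  the infimum cannot be -\<infinity>. For an empty index set, as when \<open>M_const\<close> is 0,
  the right side is \<infinity>.\<close>

lemma ereal_le_exp_ereal_INF:
  fixes c :: "'b \<Rightarrow> real"
  assumes "\<And>i. i \<in> I \<Longrightarrow> r \<le> exp (c i)"
  shows "ereal r \<le> exp_ereal (INF i\<in>I. ereal (c i))"
proof (cases "0 < r")
  case True
  have "ereal (ln r) \<le> (INF i\<in>I. ereal (c i))"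
    using assms True by (intro INF_greatest) (metis exp_le_cancel_iff exp_ln ereal_less_eq(3))
  then show ?thesis
  proof (cases "INF i\<in>I. ereal (c i)")
    case (real u)
    then have "ln r \<le> u" using \<open>ereal (ln r) \<le> _\<close> by simp
    then have "r \<le> exp u" using True by (metis exp_le_cancel_iff exp_ln)
    then show ?thesis by (simp add: real exp_ereal_def)
  qed (auto simp: exp_ereal_def)
next
  case False
  then show ?thesis
    by (auto simp: exp_ereal_def intro: order_trans[of _ 0])
qed

theorem theorem3p4:
  fixes d :: "'a::countable \<Rightarrow> 'a \<Rightarrow> real"
    and Pr :: "'a \<Rightarrow> 'w measure"
    and X :: "real \<Rightarrow> 'w \<Rightarrow> 'a"
    and Q :: "'a \<Rightarrow> 'a \<Rightarrow> real"
    and A :: "('a \<Rightarrow> real) set"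
    and \<rho> t y :: real
    and f :: "'a \<Rightarrow> real"
    and x :: 'a
  assumes metric: "Metric_space UNIV d" and nontrivial: "d \<noteq> trivial_metric"
    and chain: "regular_markov_chain Pr X Q"
    and algebra: "admissible_algebra Pr X Q A"
    and curvature: "Gamma_curvature_ge Pr X Q A \<rho>"
    and f_mem: "f \<in> A \<inter> Lip d" and Gam_finite: "sup_norm (Gam Q f) < \<infinity>"
    and t_pos: "0 < t" and y_pos: "0 < y"
  shows "ereal (measure (Pr x)
             {\<omega> \<in> space (Pr x). f (X t \<omega>) - (\<integral>\<omega>'. f (X t \<omega>') \<partial>Pr x) \<ge> y})
         \<le> exp_ereal (INF \<theta>\<in>{\<theta>. 0 < \<theta> \<and> ennreal \<theta> < M_const d Q \<rho> f t}.
              ereal (LBINT \<tau>:{0..\<theta>}. (enn2real (psi d Q \<rho> f t \<tau>) - y)))"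
proof (rule ereal_le_exp_ereal_INF)
  interpret Lipschitz_observable Pr X Q A \<rho> d f t
    using metric chain algebra curvature f_mem Gam_finite t_pos
    by (simp add: Lipschitz_observable_def Lipschitz_observable_axioms_def curved_chain_def curved_chain_axioms_def)
  fix \<theta> assume "\<theta> \<in> {\<theta>. 0 < \<theta> \<and> ennreal \<theta> < M_const d Q \<rho> f t}"
  \<comment> \<open>\<open>M_const\<close> is a supremum, so \<open>psi\<close> is finite at some
    larger \<open>\<theta>'\<close>; monotonicity passes this down to \<theta>.\<close>
  then obtain \<theta>' where \<theta>: "0 < \<theta>" "psi d Q \<rho> f t \<theta>' < \<infinity>" "ennreal \<theta> < ennreal \<theta>'"
    by (auto simp: M_const_def less_SUP_iff)
  then have "psi d Q \<rho> f t \<theta> < \<infinity>"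
    using psi_mono[of \<theta> \<theta>'] by (simp add: ennreal_less_iff order.strict_trans1)
  with \<theta>(1) show "measure (Pr x) {\<omega> \<in> space (Pr x). f (X t \<omega>) - (\<integral>\<omega>'. f (X t \<omega>') \<partial>Pr x) \<ge> y}
      \<le> exp (LBINT \<tau>:{0..\<theta>}. (enn2real (psi d Q \<rho> f t \<tau>) - y))"
    by (rule deviation)
qed

end
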